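(* Let $U\subseteq\mathbb{C}$ be an open neighborhood of $0$, let $k$ and $m\ge0$ be integers, and let $V$ be a (finite dimensional) complex vector space. Let $f_s:\mathbb{H}\to V$, $s\in U$, be functions that are smooth in $s$ and $\tau$ such that for all $\tau\in\mathbb{H}$ and $s\in U$ $$\Delta_k f_s=s(1-k-s)f_s.$$ For integers $0\le r\le m$ and $d\ge0$ write $$f_{\mathrm{L},r}^{(d)}=\Big(\partial_s^d\,\mathfrak{e}_{r,m-r}\,\mathrm{L}_k^{m-r}f_s\Big)_{s=0},\qquad f_{\mathrm{R},r}^{(d)}=\Big(\partial_s^d\,\mathfrak{e}_{r,m-r}\,\mathrm{R}_k^{r}f_s\Big)_{s=0},$$ and let, with $f=f_0$, $$f_{\mathrm L}=\begin{cases}\displaystyle\sum_{r=0}^{\min\{m,m-k\}}\frac{1}{(m-r)!\,(m-r-k)!}\,\mathfrak{e}_{r,m-r}\,\mathrm{L}_k^{m-r}f,&m\ge k,\\[1ex]\displaystyle\sum_{r=0}^{m}\frac{1}{(m-r)!\,(1-k)_{m-r}}\,\mathfrak{e}_{r,m-r}\,\mathrm{L}_k^{m-r}f,&m<k,\end{cases}$$ $$f_{\mathrm R}=\begin{cases}\displaystyle\sum_{r=\max\{0,1-k\}}^{m}\frac{1}{(m-r)!\,(r+k-1)!}\,\mathfrak{e}_{r,m-r}\,\mathrm{R}_k^{r}f,&m>-k,\\[1ex]\displaystyle\sum_{r=0}^{m}\frac{1}{(m-r)!\,(k)_{r}}\,\mathfrak{e}_{r,m-r}\,\mathrm{R}_k^{r}f,&m\le-k.\end{cases}$$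 (1) Assume that $k\le0$ or $k-m>1$. Given an integer $d\ge0$ there is a function $$f_{\mathrm L}^{(d)}\in\mathrm{span}_{\mathbb{C}}\{f_{\mathrm{L},r}^{(d-t)}:0\le r\le m,\ 0\le t\le d\}\quad\text{with}\quad\Delta_{k-m}^d f_{\mathrm L}^{(d)}=f_{\mathrm L}.$$ (2) Assume that $k>1$ or $k+m<1$. Given an integer $d\ge0$ there is a function $$f_{\mathrm R}^{(d)}\in\mathrm{span}_{\mathbb{C}}\{f_{\mathrm{R},r}^{(d-t)}:0\le r\le m,\ 0\le t\le d\}\quad\text{with}\quad\Delta_{k+m}^d f_{\mathrm R}^{(d)}=f_{\mathrm R}.$$
   Context: $\mathbb{H}=\{\tau=x+iy:y>0\}$. The weight-$k$ operators are $\mathrm{L}_k=-2iy^2\partial_{\bar\tau}$, $\mathrm{R}_k=2i\partial_\tau+ky^{-1}$, $\Delta_k=-\mathrm{R}_{k-2}\mathrm{L}_k$, with iterates $\mathrm{L}_k^j=\mathrm{L}_{k-2(j-1)}\circ\cdots\circ\mathrm{L}_{k-2}\circ\mathrm{L}_k$ and $\mathrm{R}_k^j=\mathrm{R}_{k+2(j-1)}\circ\cdots\circ\mathrm{R}_{k+2}\circ\mathrm{R}_k$; $\Delta_k^d$ is the $d$-fold composition. $\partial_s$ is the (Wirtinger) derivative $\partial/\partial s$, i.e. the complex derivative if $f_s$ is holomorphic in $s$. For $m\ge0$ let $\mathrm{Pol}_m$ be the complex vector space of polynomials of degree at most $m$ in a variable $X$, and for $0\le r\le m$ let $\mathfrak{e}_{r,m-r}:\mathbb{H}\to\mathrm{Pol}_m$,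 $$\mathfrak{e}_{r,m-r}(\tau)(X)=\frac{(-1)^{m-r}}{r!}\,y^{r-m}(X-\tau)^r(X-\bar\tau)^{m-r}.$$ Products $\mathfrak{e}_{r,m-r}\,g$ with $g:\mathbb{H}\to V$ are tensor products, with values in $\mathrm{Pol}_m\otimes V$. $(a)_r=a(a+1)\cdots(a+r-1)$ is the Pochhammer symbol, $(a)_0=1$. *)

theory Defs
  imports
    "HOL-Analysis.Analysis"
    "HOL-Library.Function_Algebras"
    "HOL-Computational_Algebra.Polynomial"
begin

text \<open>
  Complex vector spaces with a norm. On a finite dimensional space all norms are equivalent,
  so that for such spaces the norm only serves to fix the canonical topology used by
  the differentiation operators.
\<close>

class complex_normed_space = real_normed_vector +
  fixes scaleC :: "complex \<Rightarrow> 'a \<Rightarrow> 'a" (infixr "*\<^sub>C" 75)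
  assumes scaleC_add_right: "c *\<^sub>C (x + y) = c *\<^sub>C x + c *\<^sub>C y"
    and scaleC_add_left: "(c + d) *\<^sub>C x = c *\<^sub>C x + d *\<^sub>C x"
    and scaleC_scaleC: "c *\<^sub>C d *\<^sub>C x = (c * d) *\<^sub>C x"
    and scaleC_of_real: "complex_of_real a *\<^sub>C x = a *\<^sub>R x"
    and norm_scaleC: "norm (c *\<^sub>C x) = cmod c * norm x"

lemma vector_space_scaleC:
  "vector_space (scaleC :: complex \<Rightarrow> 'v \<Rightarrow> 'v::complex_normed_space)"
proof
  show "1 *\<^sub>C x = x" for x :: 'v
    using scaleC_of_real[of 1 x] by simp
qed (simp_all add: scaleC_add_right scaleC_add_left scaleC_scaleC)

instantiation complex :: complex_normed_space
begin
definition scaleC_complex :: "complex \<Rightarrow> complex \<Rightarrow> complex" where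
  "scaleC_complex c x = c * x"
instance
  by standard (simp_all add: scaleC_complex_def algebra_simps norm_mult scaleR_conv_of_real)
end

definition finite_dim_complex :: "'v::complex_normed_space itself \<Rightarrow> bool" where
  "finite_dim_complex _ \<longleftrightarrow>
     (\<exists>B :: 'v set. finite B \<and> module.span (scaleC :: complex \<Rightarrow> 'v \<Rightarrow> 'v) B = UNIV)"

definition upper_half_plane :: "complex set" ("\<H>") where
  "\<H> = {\<tau>. Im \<tau> > 0}"

text \<open>Real differentiability of order \<open>n\<close> and of all orders, for open \<open>S\<close> in a
  finite dimensional domain.\<close>

primrec Cn_on :: "nat \<Rightarrow> 'a::real_normed_vector set \<Rightarrow> ('a \<Rightarrow> 'b::real_normed_vector) \<Rightarrow> bool" where
  "Cn_on 0 S f \<longleftrightarrow> continuous_on S f"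
| "Cn_on (Suc n) S f \<longleftrightarrow>
     (\<forall>x\<in>S. f differentiable (at x)) \<and> (\<forall>v. Cn_on n S (\<lambda>x. frechet_derivative f (at x) v))"

definition smooth_on :: "'a::real_normed_vector set \<Rightarrow> ('a \<Rightarrow> 'b::real_normed_vector) \<Rightarrow> bool" where
  "smooth_on S f \<longleftrightarrow> (\<forall>n. Cn_on n S f)"

text \<open>The Wirtinger derivatives \<open>(\<partial>\<^sub>x - \<i> \<partial>\<^sub>y)/2\<close> and \<open>(\<partial>\<^sub>x + \<i> \<partial>\<^sub>y)/2\<close>.\<close>

definition wirtinger :: "(complex \<Rightarrow> 'v::complex_normed_space) \<Rightarrow> complex \<Rightarrow> 'v" where
  "wirtinger f z =
     (1/2) *\<^sub>C (frechet_derivative f (at z) 1 - \<i> *\<^sub>C frechet_derivative f (at z) \<i>)"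

definition wirtinger_cnj :: "(complex \<Rightarrow> 'v::complex_normed_space) \<Rightarrow> complex \<Rightarrow> 'v" where
  "wirtinger_cnj f z =
     (1/2) *\<^sub>C (frechet_derivative f (at z) 1 + \<i> *\<^sub>C frechet_derivative f (at z) \<i>)"

definition lower_op :: "int \<Rightarrow> (complex \<Rightarrow> 'v::complex_normed_space) \<Rightarrow> complex \<Rightarrow> 'v" where
  "lower_op k f \<tau> = (- 2 * \<i> * complex_of_real (Im \<tau>) ^ 2) *\<^sub>C wirtinger_cnj f \<tau>"

definition raise_op :: "int \<Rightarrow> (complex \<Rightarrow> 'v::complex_normed_space) \<Rightarrow> complex \<Rightarrow> 'v" where
  "raise_op k f \<tau> = (2 * \<i>) *\<^sub>C wirtinger f \<tau> + (of_int k / complex_of_real (Im \<tau>)) *\<^sub>C f \<tau>"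

definition laplace_op :: "int \<Rightarrow> (complex \<Rightarrow> 'v::complex_normed_space) \<Rightarrow> complex \<Rightarrow> 'v" where
  "laplace_op k f \<tau> = - raise_op (k - 2) (lower_op k f) \<tau>"

primrec lower_iter :: "int \<Rightarrow> nat \<Rightarrow> (complex \<Rightarrow> 'v::complex_normed_space) \<Rightarrow> complex \<Rightarrow> 'v" where
  "lower_iter k 0 f = f"
| "lower_iter k (Suc j) f = lower_op (k - 2 * int j) (lower_iter k j f)"

primrec raise_iter :: "int \<Rightarrow> nat \<Rightarrow> (complex \<Rightarrow> 'v::complex_normed_space) \<Rightarrow> complex \<Rightarrow> 'v" where
  "raise_iter k 0 f = f"
| "raise_iter k (Suc j) f = raise_op (k + 2 * int j) (raise_iter k j f)"

definition e_poly :: "nat \<Rightarrow> nat \<Rightarrow> complex \<Rightarrow> complex poly" where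
  "e_poly a b \<tau> =
     smult ((-1) ^ b / fact a * complex_of_real (Im \<tau> powi (- int b)))
       ([:- \<tau>, 1:] ^ a * [:- cnj \<tau>, 1:] ^ b)"

text \<open>
  An element \<open>\<Sum>\<^sub>j X\<^sup>j \<otimes> v\<^sub>j\<close> of the tensor product of \<open>Pol\<^sub>m\<close> and the space \<open>'v\<close> is represented by
  its coefficients \<open>j \<mapsto> v\<^sub>j\<close> (which vanish for \<open>j > m\<close>). Linear operators on \<open>'v\<close>-valued functions
  act on functions with values in the tensor product coefficientwise.
\<close>

definition tensor :: "complex poly \<Rightarrow> 'v::complex_normed_space \<Rightarrow> nat \<Rightarrow> 'v" where
  "tensor p v j = coeff p j *\<^sub>C v"

definition laplace_Pol ::
  "int \<Rightarrow> (complex \<Rightarrow> nat \<Rightarrow> 'v::complex_normed_space) \<Rightarrow> complex \<Rightarrow> nat \<Rightarrow> 'v" where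
  "laplace_Pol k F \<tau> j = laplace_op k (\<lambda>z. F z j) \<tau>"

definition scale_Pol ::
  "complex \<Rightarrow> (complex \<Rightarrow> nat \<Rightarrow> 'v::complex_normed_space) \<Rightarrow> complex \<Rightarrow> nat \<Rightarrow> 'v" where
  "scale_Pol c F \<tau> j = c *\<^sub>C F \<tau> j"

lemma vector_space_scale_Pol:
  "vector_space (scale_Pol ::
     complex \<Rightarrow> (complex \<Rightarrow> nat \<Rightarrow> 'v::complex_normed_space) \<Rightarrow> complex \<Rightarrow> nat \<Rightarrow> 'v)"
proof -
  interpret vector_space "scaleC :: complex \<Rightarrow> 'v \<Rightarrow> 'v"
    by (rule vector_space_scaleC)
  show ?thesis
    by standard (simp_all add: scale_Pol_def fun_eq_iff scaleC_add_right scaleC_add_left)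
qed

abbreviation span_Pol ::
  "(complex \<Rightarrow> nat \<Rightarrow> 'v::complex_normed_space) set \<Rightarrow> (complex \<Rightarrow> nat \<Rightarrow> 'v) set" where
  "span_Pol \<equiv> module.span scale_Pol"

text \<open>In the following, \<open>f s\<close> is the function \<open>f\<^sub>s\<close>.\<close>

definition fL_deriv ::
  "nat \<Rightarrow> int \<Rightarrow> (complex \<Rightarrow> complex \<Rightarrow> 'v::complex_normed_space) \<Rightarrow> nat \<Rightarrow> nat \<Rightarrow> complex \<Rightarrow> nat \<Rightarrow> 'v" where
  "fL_deriv m k f r d \<tau> j =
     (wirtinger ^^ d) (\<lambda>s. tensor (e_poly r (m - r) \<tau>) (lower_iter k (m - r) (f s) \<tau>) j) 0"

definition fR_deriv ::
  "nat \<Rightarrow> int \<Rightarrow> (complex \<Rightarrow> complex \<Rightarrow> 'v::complex_normed_space) \<Rightarrow> nat \<Rightarrow> nat \<Rightarrow> complex \<Rightarrow> nat \<Rightarrow> 'v" where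
  "fR_deriv m k f r d \<tau> j =
     (wirtinger ^^ d) (\<lambda>s. tensor (e_poly r (m - r) \<tau>) (raise_iter k r (f s) \<tau>) j) 0"

definition fL :: "nat \<Rightarrow> int \<Rightarrow> (complex \<Rightarrow> 'v::complex_normed_space) \<Rightarrow> complex \<Rightarrow> nat \<Rightarrow> 'v" where
  "fL m k f \<tau> j =
     (if int m \<ge> k then
        \<Sum>r = 0..nat (min (int m) (int m - k)).
          (1 / (fact (m - r) * fact (nat (int m - int r - k)))) *\<^sub>C
            tensor (e_poly r (m - r) \<tau>) (lower_iter k (m - r) f \<tau>) j
      else
        \<Sum>r = 0..m.
          (1 / (fact (m - r) * pochhammer (of_int (1 - k)) (m - r))) *\<^sub>C
            tensor (e_poly r (m - r) \<tau>) (lower_iter k (m - r) f \<tau>) j)"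

definition fR :: "nat \<Rightarrow> int \<Rightarrow> (complex \<Rightarrow> 'v::complex_normed_space) \<Rightarrow> complex \<Rightarrow> nat \<Rightarrow> 'v" where
  "fR m k f \<tau> j =
     (if int m > - k then
        \<Sum>r = nat (max 0 (1 - k))..m.
          (1 / (fact (m - r) * fact (nat (int r + k - 1)))) *\<^sub>C
            tensor (e_poly r (m - r) \<tau>) (raise_iter k r f \<tau>) j
      else
        \<Sum>r = 0..m.
          (1 / (fact (m - r) * pochhammer (of_int k) r)) *\<^sub>C
            tensor (e_poly r (m - r) \<tau>) (raise_iter k r f \<tau>) j)"

end

theory Submission
  imports Defs
begin

text \<open>
  The functions \<open>e\<^sub>r \<otimes> L\<^sup>m\<^sup>-\<^sup>r f\<^sub>s\<close> (\<open>0 \<le> r \<le> m\<close>) span a space on which the weight \<open>k - m\<close>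
  Laplacian acts by a tridiagonal matrix with entries polynomial in \<open>s\<close>. This matrix has an
  eigenvector with entries polynomial in \<open>s\<close> and eigenvalue \<open>\<mu>(s) = s (1 - k + m - s)\<close>; let \<open>\<Phi>\<^sub>s\<close>
  be the corresponding eigenfunction, which can be normalized to be \<open>f\<^sub>L\<close> at \<open>s = 0\<close>. Applying
  \<open>\<partial>\<^sub>s\<^sup>n\<close> to the eigenvalue equation at \<open>s = 0\<close> shows that the Laplacian maps the \<open>n\<close>-th derivative of \<open>\<Phi>\<close> to
  \<open>n \<mu>'(0)\<close> times the \<open>(n-1)\<close>-th one plus a multiple of the \<open>(n-2)\<close>-th one. As \<open>\<mu>(0) = 0\<close> and \<open>\<mu>'(0) \<noteq> 0\<close>,
  the \<open>d\<close>-th power of the Laplacian sends \<open>\<partial>\<^sub>s\<^sup>d \<Phi>\<close> at \<open>s = 0\<close> to a nonzero multiple of \<open>\<Phi>\<^sub>0\<close>. For \<open>f\<^sub>R\<close> one uses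
  \<open>e\<^sub>r \<otimes> R\<^sup>r f\<^sub>s\<close> and \<open>\<mu>(s) = s (1 - k - m - s)\<close>.
\<close>

text \<open>The matrix is tridiagonal because \<open>e_poly\<close> is a ladder: raising and
  lowering move it to a neighbouring index, while the sl2 relation between the two operators turns a
  raised or lowered iterate of \<open>f s\<close> back into a multiple of a neighbouring iterate.
  The eigenvalue \<mu>(s) is s (1 - k' - s) for the new weight k' = k - m or k' = k + m, so the
  spectral parameter s is kept, and \<mu>'(0) = 1 - k'. The eigenvector has the Pochhammer
  coefficients of \<open>fL\<close> or \<open>fR\<close> with k replaced by k + s, multiplied by a
  common factor that clears the denominators. Polynomial entries matter twice: there is no pole at s
  = 0, and Leibniz' rule expands the derivatives of \<Phi> with constant scalars, as a complex span
  demands. The family is smooth only in the real sense and need not be holomorphic in s. Exchanging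
  the derivative in s with the Laplacian therefore rests on the symmetry of second derivatives of
  jointly smooth functions with values in a normed space.\<close>

interpretation scaleC: vector_space "scaleC :: complex \<Rightarrow> 'v \<Rightarrow> 'v::complex_normed_space"
  by (rule vector_space_scaleC)

section \<open>Complex scalar multiplication and Frechet derivatives\<close>

lemma bounded_bilinear_scaleC:
  "bounded_bilinear (scaleC :: complex \<Rightarrow> 'v \<Rightarrow> 'v::complex_normed_space)"
proof
  fix c d :: complex and x y :: 'v and r :: real
  have "(r *\<^sub>R c) *\<^sub>C x = of_real r *\<^sub>C c *\<^sub>C x" "c *\<^sub>C (r *\<^sub>R x) = c *\<^sub>C of_real r *\<^sub>C x"
    "r *\<^sub>R (c *\<^sub>C x) = of_real r *\<^sub>C c *\<^sub>C x"
    by (simp_all add: scaleR_conv_of_real scaleC_of_real scaleC_scaleC del: scaleC.scale_scale)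
       (simp_all flip: scaleC_of_real add: scaleC_scaleC)
  then show "(r *\<^sub>R c) *\<^sub>C x = r *\<^sub>R (c *\<^sub>C x)" "c *\<^sub>C (r *\<^sub>R x) = r *\<^sub>R (c *\<^sub>C x)"
    by (simp_all add: scaleC_scaleC mult.commute)
  show "\<exists>K. \<forall>(a::complex) b::'v. norm (a *\<^sub>C b) \<le> norm a * norm b * K"
    by (intro exI[of _ 1]) (simp add: norm_scaleC)
qed (simp_all add: scaleC_add_left scaleC_add_right)

lemma bounded_linear_scaleC: "bounded_linear (\<lambda>x::'v::complex_normed_space. c *\<^sub>C x)"
  by (rule bounded_bilinear.bounded_linear_right[OF bounded_bilinear_scaleC])

lemmas has_derivative_scaleC = bounded_bilinear.FDERIV[OF bounded_bilinear_scaleC]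

lemma has_derivative_imp_frechet:
  "(f has_derivative f') (at x) \<Longrightarrow> frechet_derivative f (at x) v = f' v"
  by (metis frechet_derivative_at)

lemma differentiable_cong_open:
  assumes "open S" "x \<in> S" "\<And>y. y \<in> S \<Longrightarrow> f y = g y" "f differentiable (at x)"
  shows "g differentiable (at x)"
  using assms has_derivative_transform_within_open unfolding differentiable_def by metis

lemma frechet_derivative_cong_open:
  assumes "open S" "x \<in> S" "\<And>y. y \<in> S \<Longrightarrow> f y = g y"
  shows "frechet_derivative f (at x) = frechet_derivative g (at x)"
proof -
  have "(f has_derivative D) (at x) \<longleftrightarrow> (g has_derivative D) (at x)" for D
    using assms has_derivative_transform_within_open by metis
  then show ?thesis unfolding frechet_derivative_def by simp
qed

section \<open>Smooth functions\<close>

lemma Cn_on_cong: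
  assumes "open S" "\<And>x. x \<in> S \<Longrightarrow> f x = g x" "Cn_on n S f"
  shows "Cn_on n S g"
  using assms(2,3)
proof (induction n arbitrary: f g)
  case 0
  then show ?case by (simp cong: continuous_on_cong)
next
  case (Suc n)
  have "g differentiable (at x)" if "x \<in> S" for x
    using differentiable_cong_open[OF assms(1) that Suc.prems(1)] Suc.prems(2) that by auto
  moreover have "Cn_on n S (\<lambda>x. frechet_derivative g (at x) v)" for v
    using Suc.IH[of "\<lambda>x. frechet_derivative f (at x) v"]
      frechet_derivative_cong_open[OF assms(1) _ Suc.prems(1)] Suc.prems(2) by auto
  ultimately show ?case by simp
qed

text \<open>\<open>Cn_on\<close> is phrased with \<open>frechet_derivative\<close>. By uniqueness of
  derivatives, and because on an open set \<open>Cn_on\<close> depends only on the values there, any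
  explicit formula for the derivative may take its place.\<close>

lemma Cn_on_SucI:
  assumes "open S" "\<And>x. x \<in> S \<Longrightarrow> (f has_derivative f' x) (at x)"
    "\<And>v. Cn_on n S (\<lambda>x. f' x v)"
  shows "Cn_on (Suc n) S f"
proof -
  have "Cn_on n S (\<lambda>x. frechet_derivative f (at x) v)" for v
    by (rule Cn_on_cong[OF assms(1) _ assms(3)[of v]])
       (simp add: has_derivative_imp_frechet[OF assms(2)])
  then show ?thesis using assms(2) by (auto simp: differentiable_def)
qed

lemma Cn_on_has_derivative:
  "Cn_on (Suc n) S f \<Longrightarrow> x \<in> S \<Longrightarrow> (f has_derivative frechet_derivative f (at x)) (at x)"
  by (simp flip: frechet_derivative_works)

text \<open>Serves the product rule, where the undifferentiated factors reappear beside the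
  derivatives and are needed with one order less.\<close>

lemma Cn_on_Suc_imp: "Cn_on (Suc n) S f \<Longrightarrow> Cn_on n S f"
proof (induction n arbitrary: f)
  case 0
  then show ?case
    by (auto intro!: continuous_at_imp_continuous_on differentiable_imp_continuous_within)
next
  case (Suc n)
  show ?case using Suc.IH Suc.prems by (subst Cn_on.simps) (auto simp del: Cn_on.simps simp: Cn_on.simps(2)[of "Suc n"])
qed

lemma Cn_on_const: "Cn_on n S (\<lambda>_. c)"
  by (induction n arbitrary: c) simp_all

lemma Cn_on_add:
  assumes "open S" "Cn_on n S f" "Cn_on n S g"
  shows "Cn_on n S (\<lambda>x. f x + g x)"
  using assms(2,3)
proof (induction n arbitrary: f g)
  case (Suc n)
  show ?case
    by (rule Cn_on_SucI[OF assms(1)], rule has_derivative_add[OF Suc.prems[THEN Cn_on_has_derivative]])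
       (use Suc in auto)
qed (simp add: continuous_on_add)

lemma Cn_on_sum:
  assumes "open S" "\<And>i. i \<in> I \<Longrightarrow> Cn_on n S (f i)"
  shows "Cn_on n S (\<lambda>x. \<Sum>i\<in>I. f i x)"
  using assms(2)
  by (induction I rule: infinite_finite_induct) (auto intro: Cn_on_const Cn_on_add[OF assms(1)])

lemma Cn_on_scaleC:
  assumes "open S" "Cn_on n S f" "Cn_on n S g"
  shows "Cn_on n S (\<lambda>x. f x *\<^sub>C g x)"
  using assms(2,3)
proof (induction n arbitrary: f g)
  case 0
  then show ?case by (simp add: bounded_bilinear.continuous_on[OF bounded_bilinear_scaleC])
next
  case (Suc n)
  show ?case
    by (rule Cn_on_SucI[OF assms(1)], rule has_derivative_scaleC[OF Suc.prems[THEN Cn_on_has_derivative]])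
       (use Suc Suc.prems[THEN Cn_on_Suc_imp] in \<open>auto intro!: Cn_on_add[OF assms(1)]\<close>)
qed

text \<open>An affine inner map has the constant derivative \<open>A\<close>, so a directional
  derivative is again an outer function composed with the same map, and the induction closes.
  Projections from a product and embeddings of its slices are the inner maps required later.\<close>

lemma Cn_on_compose_affine:
  assumes "open S" "bounded_linear A" "\<And>x. x \<in> S \<Longrightarrow> A x + b \<in> T" "Cn_on n T h"
  shows "Cn_on n S (\<lambda>x. h (A x + b))"
  using assms(4)
proof (induction n arbitrary: h)
  case 0
  have "continuous_on S (\<lambda>x. A x + b)"
    using assms(2) by (intro continuous_intros linear_continuous_on)
  then show ?case using 0 assms(3) by (auto intro: continuous_on_compose2)
next
  case (Suc n)
  have D: "((\<lambda>x. h (A x + b)) has_derivative (\<lambda>v. frechet_derivative h (at (A x + b)) (A v))) (at x)"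
    if "x \<in> S" for x
  proof -
    have 1: "((\<lambda>x. A x + b) has_derivative A) (at x)"
      using bounded_linear_imp_has_derivative[OF assms(2)] by (auto intro!: derivative_eq_intros)
    show ?thesis
      using has_derivative_compose[OF 1 Cn_on_has_derivative[OF Suc.prems assms(3)[OF that]]] .
  qed
  show ?case
    by (rule Cn_on_SucI[OF assms(1) D]) (use Suc in auto)
qed

lemma Cn_on_bounded_linear:
  assumes "open S" "bounded_linear A"
  shows "Cn_on n S A"
proof (cases n)
  case 0
  then show ?thesis using assms(2) by (simp add: linear_continuous_on)
next
  case (Suc k)
  show ?thesis unfolding Suc
    by (rule Cn_on_SucI[OF assms(1) bounded_linear_imp_has_derivative[OF assms(2)]])
       (simp add: Cn_on_const)
qed

lemma smooth_on_cong:
  "open S \<Longrightarrow> (\<And>x. x \<in> S \<Longrightarrow> f x = g x) \<Longrightarrow> smooth_on S f \<Longrightarrow> smooth_on S g"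
  unfolding smooth_on_def by (metis Cn_on_cong)

lemma smooth_on_differentiable: "smooth_on S f \<Longrightarrow> x \<in> S \<Longrightarrow> f differentiable (at x)"
  unfolding smooth_on_def by (metis Cn_on.simps(2))

lemma smooth_on_has_derivative:
  "smooth_on S f \<Longrightarrow> x \<in> S \<Longrightarrow> (f has_derivative frechet_derivative f (at x)) (at x)"
  by (simp add: smooth_on_differentiable flip: frechet_derivative_works)

lemma smooth_on_continuous: "smooth_on S f \<Longrightarrow> continuous_on S f"
  unfolding smooth_on_def by (metis Cn_on.simps(1))

lemma smooth_on_frechet: "smooth_on S f \<Longrightarrow> smooth_on S (\<lambda>x. frechet_derivative f (at x) v)"
  unfolding smooth_on_def by (metis Cn_on.simps(2))

lemma smooth_on_const: "smooth_on S (\<lambda>_. c)"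
  by (simp add: smooth_on_def Cn_on_const)

lemma smooth_on_add:
  "open S \<Longrightarrow> smooth_on S f \<Longrightarrow> smooth_on S g \<Longrightarrow> smooth_on S (\<lambda>x. f x + g x)"
  by (simp add: smooth_on_def Cn_on_add)

lemma smooth_on_sum:
  "open S \<Longrightarrow> (\<And>i. i \<in> I \<Longrightarrow> smooth_on S (f i)) \<Longrightarrow> smooth_on S (\<lambda>x. \<Sum>i\<in>I. f i x)"
  by (simp add: smooth_on_def Cn_on_sum)

lemma smooth_on_scaleC:
  "open S \<Longrightarrow> smooth_on S f \<Longrightarrow> smooth_on S g \<Longrightarrow> smooth_on S (\<lambda>x. f x *\<^sub>C g x)"
  by (simp add: smooth_on_def Cn_on_scaleC)

lemma smooth_on_compose_affine:
  assumes "open S" "bounded_linear A" "\<And>x. x \<in> S \<Longrightarrow> A x + b \<in> T" "smooth_on T h"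
  shows "smooth_on S (\<lambda>x. h (A x + b))"
  using assms Cn_on_compose_affine[OF assms(1-3)] by (auto simp: smooth_on_def)

lemma smooth_on_bounded_linear: "open S \<Longrightarrow> bounded_linear A \<Longrightarrow> smooth_on S A"
  by (simp add: smooth_on_def Cn_on_bounded_linear)

section \<open>Symmetry of second derivatives\<close>

text \<open>The mean value inequality, applied after subtracting the linear function with slope
  \<open>c\<close>.\<close>

lemma increment_bound:
  fixes f :: "real \<Rightarrow> 'b::real_normed_vector"
  assumes "0 \<le> t" "\<And>a. a \<in> {0..t} \<Longrightarrow> (f has_vector_derivative f' a) (at a)"
    "\<And>a. a \<in> {0..t} \<Longrightarrow> norm (f' a - c) \<le> B"
  shows "norm (f t - f 0 - t *\<^sub>R c) \<le> t * B"
proof -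
  have "norm ((f t - t *\<^sub>R c) - (f 0 - 0 *\<^sub>R c)) \<le> B * norm (t - 0)"
  proof (rule differentiable_bound[where S = "{0..t}" and f' = "\<lambda>a h. h *\<^sub>R (f' a - c)"])
    show "((\<lambda>a. f a - a *\<^sub>R c) has_derivative (\<lambda>h. h *\<^sub>R (f' a - c))) (at a within {0..t})"
      if "a \<in> {0..t}" for a
      using assms(2)[OF that, unfolded has_vector_derivative_def, THEN has_derivative_at_withinI]
      by (auto intro!: derivative_eq_intros simp: algebra_simps)
    show "onorm (\<lambda>h. h *\<^sub>R (f' a - c)) \<le> B" if "a \<in> {0..t}" for a
      using assms(3)[OF that] by (intro onorm_le) (simp add: mult.commute[of B] mult_left_mono)
  qed (use assms in auto)
  moreover have "(f t - t *\<^sub>R c) - (f 0 - 0 *\<^sub>R c) = f t - f 0 - t *\<^sub>R c" by (simp add: algebra_simps)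
  ultimately show ?thesis using assms(1) by (metis abs_of_nonneg diff_zero mult.commute real_norm_def)
qed

text \<open>Two nested increments: the increment along w, as a function of the step along v, has as
  derivative the w-increment of the v-derivative. The latter is within t B of t c by
  \<open>increment_bound\<close>, and a second use of that lemma finishes.\<close>

lemma second_difference_bound:
  fixes f :: "'a::real_normed_vector \<Rightarrow> 'b::real_normed_vector"
  assumes f: "smooth_on S f" and "0 \<le> t"
    and P: "\<And>a b. a \<in> {0..t} \<Longrightarrow> b \<in> {0..t} \<Longrightarrow> x + a *\<^sub>R v + b *\<^sub>R w \<in> S"
    and B: "\<And>a b. a \<in> {0..t} \<Longrightarrow> b \<in> {0..t} \<Longrightarrow>
      norm (frechet_derivative (\<lambda>y. frechet_derivative f (at y) v) (at (x + a *\<^sub>R v + b *\<^sub>R w)) w - c) \<le> B"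
  shows "norm (f (x + t *\<^sub>R v + t *\<^sub>R w) - f (x + t *\<^sub>R v) - f (x + t *\<^sub>R w) + f x - (t * t) *\<^sub>R c) \<le> t * (t * B)"
proof -
  let ?Dv = "\<lambda>y. frechet_derivative f (at y) v"
  have line: "((\<lambda>a. h (y + a *\<^sub>R u)) has_vector_derivative frechet_derivative h (at (y + a *\<^sub>R u)) u) (at a)"
    if "smooth_on S h" "y + a *\<^sub>R u \<in> S" for h :: "'a \<Rightarrow> 'b" and y u a
  proof -
    note h = smooth_on_has_derivative[OF that]
    have 1: "((\<lambda>a. y + a *\<^sub>R u) has_derivative (\<lambda>a. a *\<^sub>R u)) (at a)"
      by (auto intro!: derivative_eq_intros)
    show ?thesis
      unfolding has_vector_derivative_def
      using has_derivative_compose[OF 1 h] linear_cmul[OF has_derivative_linear[OF h]] by simp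
  qed
  let ?g = "\<lambda>a. f (x + t *\<^sub>R w + a *\<^sub>R v) - f (x + a *\<^sub>R v)"
  let ?g' = "\<lambda>a. ?Dv (x + t *\<^sub>R w + a *\<^sub>R v) - ?Dv (x + a *\<^sub>R v)"
  have "norm (?g t - ?g 0 - t *\<^sub>R (t *\<^sub>R c)) \<le> t * (t * B)"
  proof (rule increment_bound[OF \<open>0 \<le> t\<close>, of ?g ?g'])
    fix a assume a: "a \<in> {0..t}"
    show "(?g has_vector_derivative ?g' a) (at a)"
      by (intro derivative_intros line[OF f])
         (use P[OF a, of t] P[OF a, of 0] a in \<open>auto simp: algebra_simps\<close>)
    let ?h = "\<lambda>b. ?Dv (x + a *\<^sub>R v + b *\<^sub>R w)"
    have "norm (?h t - ?h 0 - t *\<^sub>R c) \<le> t * B"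
      by (rule increment_bound[OF \<open>0 \<le> t\<close> line[OF smooth_on_frechet[OF f]]]) (use P B a in auto)
    then show "norm (?g' a - t *\<^sub>R c) \<le> t * B"
      by (simp add: algebra_simps)
  qed
  then show ?thesis by (simp add: algebra_simps)
qed

text \<open>The second difference over a parallelogram is symmetric in v and w, while after division
  by t^2 it is close to either mixed derivative. Continuity of both at x makes the error arbitrarily
  small.\<close>

lemma smooth_on_symmetric:
  fixes f :: "'a::real_normed_vector \<Rightarrow> 'b::real_normed_vector"
  assumes "open S" "x \<in> S" and f: "smooth_on S f"
  shows "frechet_derivative (\<lambda>y. frechet_derivative f (at y) v) (at x) w =
         frechet_derivative (\<lambda>y. frechet_derivative f (at y) w) (at x) v"
proof -
  define G where "G v w y = frechet_derivative (\<lambda>y. frechet_derivative f (at y) v) (at y) w" for v w y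
  have "norm (G v w x - G w v x) \<le> e" if "0 < e" for e
  proof -
    have cont: "continuous (at x) (G p q)" for p q
      using smooth_on_continuous[OF smooth_on_frechet[OF smooth_on_frechet[OF f]]] assms(1,2)
      by (auto simp: G_def[abs_def] continuous_on_eq_continuous_at)
    have "\<forall>\<^sub>F y in nhds x. dist (G p q y) (G p q x) < e/2" for p q
      using cont[of p q] \<open>0 < e\<close> by (metis half_gt_zero isCont_def tendsto_at_iff_tendsto_nhds tendstoD)
    then have "\<forall>\<^sub>F y in nhds x. y \<in> S \<and> dist (G v w y) (G v w x) < e/2 \<and> dist (G w v y) (G w v x) < e/2"
      using assms(1,2) by (auto intro!: eventually_conj eventually_nhds_in_open)
    then obtain \<delta> where "\<delta> > 0" and \<delta>: "\<And>y. dist y x < \<delta> \<Longrightarrow> y \<in> S \<and> dist (G v w y) (G v w x) < e/2 \<and> dist (G w v y) (G w v x) < e/2"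
      by (auto simp: eventually_nhds_metric)
    \<comment> \<open>Keeps the parallelogram with sides t v and t w within distance \<delta>/2 of
      x; the summand 1 avoids a zero denominator if both directions vanish.\<close>
    define t where "t = \<delta> / (2 * (norm v + norm w + 1))"
    have n: "norm v + norm w + 1 > 0" by (smt (verit) norm_ge_zero)
    then have "t > 0" using \<open>\<delta> > 0\<close> by (simp add: t_def)
    have near: "dist (x + a *\<^sub>R v + b *\<^sub>R w) x < \<delta>" if "a \<in> {0..t}" "b \<in> {0..t}" for a b
    proof -
      have "dist (x + a *\<^sub>R v + b *\<^sub>R w) x \<le> a * norm v + b * norm w"
        using norm_triangle_ineq[of "a *\<^sub>R v" "b *\<^sub>R w"] that by (simp add: dist_norm add.assoc)
      also have "\<dots> \<le> t * norm v + t * norm w"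
        using that by (intro add_mono mult_right_mono) auto
      also have "\<dots> \<le> t * (norm v + norm w + 1)" using \<open>t > 0\<close> by (simp add: algebra_simps)
      also have "\<dots> = \<delta> / 2" using n by (simp add: t_def del: distrib_right_numeral distrib_left_numeral)
      finally show ?thesis using \<open>\<delta> > 0\<close> by simp
    qed
    let ?d = "f (x + t *\<^sub>R v + t *\<^sub>R w) - f (x + t *\<^sub>R v) - f (x + t *\<^sub>R w) + f x"
    have 1: "norm (?d - (t * t) *\<^sub>R G v w x) \<le> t * (t * (e/2))"
      by (rule second_difference_bound[OF f less_imp_le[OF \<open>t > 0\<close>]])
         (use \<delta>[OF near] in \<open>auto simp: G_def dist_norm intro!: less_imp_le\<close>)
    have near': "dist (x + a *\<^sub>R w + b *\<^sub>R v) x < \<delta>" if "a \<in> {0..t}" "b \<in> {0..t}" for a b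
      using near[OF that(2,1)] by (simp add: algebra_simps)
    have "norm (f (x + t *\<^sub>R w + t *\<^sub>R v) - f (x + t *\<^sub>R w) - f (x + t *\<^sub>R v) + f x - (t * t) *\<^sub>R G w v x) \<le> t * (t * (e/2))"
      by (rule second_difference_bound[OF f less_imp_le[OF \<open>t > 0\<close>]])
         (use \<delta>[OF near'] in \<open>auto simp: G_def dist_norm intro!: less_imp_le\<close>)
    then have 2: "norm (?d - (t * t) *\<^sub>R G w v x) \<le> t * (t * (e/2))"
      by (simp add: algebra_simps)
    have "(t * t) * norm (G v w x - G w v x) = norm ((?d - (t * t) *\<^sub>R G w v x) - (?d - (t * t) *\<^sub>R G v w x))"
      by (simp flip: scaleR_diff_right)
    also have "\<dots> \<le> t * (t * (e/2)) + t * (t * (e/2))"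
      by (rule order_trans[OF norm_triangle_ineq4 add_mono[OF 2 1]])
    also have "\<dots> = (t * t) * e" by simp
    finally show ?thesis using \<open>t > 0\<close> by simp
  qed
  then have "norm (G v w x - G w v x) \<le> 0" by (rule field_le_epsilon[of _ 0, simplified])
  then show ?thesis by (simp add: G_def)
qed

section \<open>Wirtinger calculus\<close>

text \<open>A common form for both Wirtinger derivatives, in one variable and, with directions (u,
  0) or (0, u), in either variable of a product. One commutation lemma then covers every pair of
  them.\<close>

definition dir_op :: "'a::real_normed_vector \<Rightarrow> 'a \<Rightarrow> complex \<Rightarrow> ('a \<Rightarrow> 'v::complex_normed_space) \<Rightarrow> 'a \<Rightarrow> 'v" where
  "dir_op u w c f x = (1/2) *\<^sub>C (frechet_derivative f (at x) u + c *\<^sub>C frechet_derivative f (at x) w)"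

lemma wirtinger_conv_dir_op: "wirtinger = dir_op 1 \<i> (-\<i>)"
  by (simp add: fun_eq_iff wirtinger_def dir_op_def)

lemma wirtinger_cnj_conv_dir_op: "wirtinger_cnj = dir_op 1 \<i> \<i>"
  by (simp add: fun_eq_iff wirtinger_cnj_def dir_op_def)

lemma dir_op_cong:
  "open S \<Longrightarrow> x \<in> S \<Longrightarrow> (\<And>y. y \<in> S \<Longrightarrow> f y = g y) \<Longrightarrow> dir_op u w c f x = dir_op u w c g x"
  unfolding dir_op_def using frechet_derivative_cong_open[of S x f g] by simp

lemma smooth_on_dir_op: "open S \<Longrightarrow> smooth_on S f \<Longrightarrow> smooth_on S (dir_op u w c f)"
  unfolding dir_op_def[abs_def]
  by (intro smooth_on_scaleC smooth_on_add smooth_on_const smooth_on_frechet)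

lemma dir_op_add:
  assumes "f differentiable (at x)" "g differentiable (at x)"
  shows "dir_op u w c (\<lambda>y. f y + g y) x = dir_op u w c f x + dir_op u w c g x"
  using assms
  by (simp add: dir_op_def frechet_derivative_works
      has_derivative_imp_frechet[OF has_derivative_add] scaleC.scale_right_distrib)

lemma dir_op_scaleC:
  assumes "f differentiable (at x)"
  shows "dir_op u w c (\<lambda>y. a *\<^sub>C f y) x = a *\<^sub>C dir_op u w c f x"
  using assms
  by (simp add: dir_op_def frechet_derivative_works
      has_derivative_imp_frechet[OF bounded_linear.has_derivative[OF bounded_linear_scaleC]]
      scaleC.scale_right_distrib mult.commute)

lemma dir_op_commute:
  assumes "open S" "x \<in> S" "smooth_on S f"
  shows "dir_op u w c (dir_op u' w' c' f) x = dir_op u' w' c' (dir_op u w c f) x"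
proof -
  have D: "frechet_derivative (dir_op p q a f) (at x) v =
      (1/2) *\<^sub>C (frechet_derivative (\<lambda>y. frechet_derivative f (at y) p) (at x) v
        + a *\<^sub>C frechet_derivative (\<lambda>y. frechet_derivative f (at y) q) (at x) v)" for p q a v
    unfolding dir_op_def[abs_def]
    by (rule has_derivative_imp_frechet, intro bounded_linear.has_derivative[OF bounded_linear_scaleC]
        has_derivative_add smooth_on_has_derivative[OF smooth_on_frechet[OF assms(3)] assms(2)])
  show ?thesis
    unfolding dir_op_def[of u w] dir_op_def[of u' w'] D
    using smooth_on_symmetric[OF assms]
    by (simp add: scaleC.scale_right_distrib mult.commute add_ac)
qed

text \<open>The real differential in the basis dz, d(cnj z). Differentiability is part of the
  statement, so that formulas combine like those for \<open>has_derivative\<close>.\<close>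

definition has_wirtinger :: "(complex \<Rightarrow> 'v::complex_normed_space) \<Rightarrow> 'v \<Rightarrow> 'v \<Rightarrow> complex \<Rightarrow> bool" where
  "has_wirtinger f a b z \<longleftrightarrow> (f has_derivative (\<lambda>v. v *\<^sub>C a + cnj v *\<^sub>C b)) (at z)"

lemma has_wirtingerD:
  assumes "has_wirtinger f a b z"
  shows "f differentiable (at z)" "wirtinger f z = a" "wirtinger_cnj f z = b"
proof -
  note D = has_derivative_imp_frechet[OF assms[unfolded has_wirtinger_def]]
  show "f differentiable (at z)"
    using assms by (auto simp: has_wirtinger_def differentiable_def)
  have "a + b - \<i> *\<^sub>C (\<i> *\<^sub>C a + (- \<i>) *\<^sub>C b) = 2 *\<^sub>C a" "a + b + \<i> *\<^sub>C (\<i> *\<^sub>C a + (- \<i>) *\<^sub>C b) = 2 *\<^sub>C b"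
    using scaleC_add_left[of 1 1 a] scaleC_add_left[of 1 1 b]
    by (simp_all add: scaleC.scale_right_distrib scaleC.scale_right_diff_distrib)
  then show "wirtinger f z = a" "wirtinger_cnj f z = b"
    by (simp_all add: wirtinger_def wirtinger_cnj_def D)
qed

lemma has_wirtingerI:
  assumes "f differentiable (at z)"
  shows "has_wirtinger f (wirtinger f z) (wirtinger_cnj f z) z"
proof -
  let ?D = "frechet_derivative f (at z)"
  have D: "(f has_derivative ?D) (at z)" using assms by (simp add: frechet_derivative_works)
  have "?D v = v *\<^sub>C wirtinger f z + cnj v *\<^sub>C wirtinger_cnj f z" for v
  proof -
    have "v = Re v *\<^sub>R 1 + Im v *\<^sub>R \<i>" by (simp add: complex_eq_iff)
    moreover have "?D (Re v *\<^sub>R 1 + Im v *\<^sub>R \<i>) = Re v *\<^sub>R ?D 1 + Im v *\<^sub>R ?D \<i>"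
      by (simp only: linear_add[OF has_derivative_linear[OF D]] linear_cmul[OF has_derivative_linear[OF D]])
    ultimately have "?D v = Re v *\<^sub>R ?D 1 + Im v *\<^sub>R ?D \<i>"
      by simp
    \<comment> \<open>Re v and Im v are written through v and cnj v; collecting the coefficients of
      these two gives the Wirtinger derivatives.\<close>
    also have "\<dots> = ((v + cnj v) / 2) *\<^sub>C ?D 1 + ((cnj v - v) * \<i> / 2) *\<^sub>C ?D \<i>"
    proof -
      have "(v + cnj v) / 2 = of_real (Re v)" "(cnj v - v) * \<i> / 2 = of_real (Im v)"
        by (simp_all add: complex_eq_iff)
      then show ?thesis by (simp only: scaleC_of_real)
    qed
    also have "\<dots> = v *\<^sub>C wirtinger f z + cnj v *\<^sub>C wirtinger_cnj f z"
      by (simp add: wirtinger_def wirtinger_cnj_def scaleC.scale_right_distrib scaleC.scale_left_distrib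
          scaleC.scale_right_diff_distrib scaleC.scale_left_diff_distrib add_divide_distrib diff_divide_distrib
          left_diff_distrib)
    finally show ?thesis .
  qed
  then have "?D = (\<lambda>v. v *\<^sub>C wirtinger f z + cnj v *\<^sub>C wirtinger_cnj f z)" by blast
  then show ?thesis using D by (simp add: has_wirtinger_def)
qed

lemma has_wirtinger_const: "has_wirtinger (\<lambda>_. c) 0 0 z"
  by (simp add: has_wirtinger_def)

lemma has_wirtinger_id: "has_wirtinger (\<lambda>z. z) 1 0 z"
  by (simp add: has_wirtinger_def scaleC_complex_def)

lemma has_wirtinger_cnj: "has_wirtinger cnj 0 1 z"
  by (simp add: has_wirtinger_def scaleC_complex_def bounded_linear_imp_has_derivative bounded_linear_cnj)

lemma has_wirtinger_add:
  "has_wirtinger f a b z \<Longrightarrow> has_wirtinger g c d z \<Longrightarrow> has_wirtinger (\<lambda>z. f z + g z) (a + c) (b + d) z"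
  unfolding has_wirtinger_def
  by (drule (1) has_derivative_add) (simp add: scaleC.scale_right_distrib add_ac)

lemma has_wirtinger_sum:
  "(\<And>i. i \<in> I \<Longrightarrow> has_wirtinger (f i) (a i) (b i) z) \<Longrightarrow>
    has_wirtinger (\<lambda>z. \<Sum>i\<in>I. f i z) (\<Sum>i\<in>I. a i) (\<Sum>i\<in>I. b i) z"
  by (induction I rule: infinite_finite_induct) (auto intro: has_wirtinger_const has_wirtinger_add)

lemma has_wirtinger_scaleC:
  assumes "has_wirtinger f a b z" "has_wirtinger g c d z"
  shows "has_wirtinger (\<lambda>z. f z *\<^sub>C g z) (a *\<^sub>C g z + f z *\<^sub>C c) (b *\<^sub>C g z + f z *\<^sub>C d) z"
  using has_derivative_scaleC[OF assms[unfolded has_wirtinger_def]]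
  by (simp add: has_wirtinger_def scaleC.scale_right_distrib scaleC.scale_left_distrib
      scaleC_complex_def ac_simps)

lemma has_wirtinger_mult:
  fixes f g :: "complex \<Rightarrow> complex"
  assumes "has_wirtinger f a b z" "has_wirtinger g c d z"
  shows "has_wirtinger (\<lambda>z. f z * g z) (a * g z + f z * c) (b * g z + f z * d) z"
  using has_wirtinger_scaleC[OF assms] by (simp add: scaleC_complex_def)

lemma wirtinger_scaleC_fun:
  assumes "g differentiable (at z)" "h differentiable (at z)"
  shows "wirtinger (\<lambda>z. g z *\<^sub>C h z) z = wirtinger g z *\<^sub>C h z + g z *\<^sub>C wirtinger h z"
    and "wirtinger_cnj (\<lambda>z. g z *\<^sub>C h z) z = wirtinger_cnj g z *\<^sub>C h z + g z *\<^sub>C wirtinger_cnj h z"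
  using has_wirtingerD[OF has_wirtinger_scaleC[OF assms[THEN has_wirtingerI]]] by simp_all

lemma has_wirtinger_inverse_Im:
  assumes "Im z \<noteq> 0"
  shows "has_wirtinger (\<lambda>z. inverse (of_real (Im z)))
    (\<i> / 2 * inverse (of_real (Im z)) ^ 2) (- \<i> / 2 * inverse (of_real (Im z)) ^ 2) z"
proof -
  have "((\<lambda>z. inverse (complex_of_real (Im z))) has_derivative
      (\<lambda>v. - (inverse (of_real (Im z)) * of_real (Im v) * inverse (of_real (Im z))))) (at z)"
    using assms by (auto intro!: derivative_eq_intros)
  moreover have "- (w * of_real (Im v) * w) = v *\<^sub>C (\<i> / 2 * w ^ 2) + cnj v *\<^sub>C (- \<i> / 2 * w ^ 2)"
    for v w
  proof -
    have v: "complex_of_real (Im v) = (cnj v - v) * \<i> / 2"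
      by (simp add: complex_eq_iff)
    show ?thesis unfolding v by (simp add: scaleC_complex_def field_simps power2_eq_square)
  qed
  ultimately show ?thesis
    by (simp add: has_wirtinger_def)
qed

lemma open_upper_half_plane: "open \<H>"
  unfolding upper_half_plane_def by (rule open_halfspace_Im_gt)

text \<open>The derivative of 1/y is a constant multiple, depending on the direction, of the square
  of 1/y itself, so the induction on the order closes.\<close>

lemma smooth_on_inverse_Im: "smooth_on \<H> (\<lambda>z. inverse (complex_of_real (Im z)))"
proof -
  let ?w = "\<lambda>z. inverse (complex_of_real (Im z))"
  have D: "(?w has_derivative (\<lambda>v. (- of_real (Im v)) *\<^sub>C (?w z *\<^sub>C ?w z))) (at z)" if "z \<in> \<H>" for z
    using that by (auto intro!: derivative_eq_intros simp: upper_half_plane_def scaleC_complex_def)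
  have "Cn_on n \<H> ?w" for n
  proof (induction n)
    case 0
    show ?case by (auto intro!: continuous_intros simp: upper_half_plane_def)
  next
    case (Suc n)
    show ?case
      by (rule Cn_on_SucI[OF open_upper_half_plane D])
         (assumption, intro Cn_on_scaleC[OF open_upper_half_plane] Cn_on_const Suc)
  qed
  then show ?thesis by (simp add: smooth_on_def)
qed

lemma smooth_on_Im: "smooth_on \<H> (\<lambda>z. complex_of_real (Im z))"
  by (intro smooth_on_bounded_linear open_upper_half_plane
      bounded_linear_compose[OF bounded_linear_of_real bounded_linear_Im])

subsection \<open>The polynomials \<open>e_poly\<close>\<close>

text \<open>Coefficientwise like \<open>tensor\<close>, so that each coefficient of
  \<open>e_poly\<close> can serve as a scalar factor, while the product rule can still be stated for
  products of polynomials.\<close>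

definition has_wirtinger_poly ::
  "(complex \<Rightarrow> complex poly) \<Rightarrow> complex poly \<Rightarrow> complex poly \<Rightarrow> complex \<Rightarrow> bool" where
  "has_wirtinger_poly P A B z \<longleftrightarrow> (\<forall>j. has_wirtinger (\<lambda>z. coeff (P z) j) (coeff A j) (coeff B j) z)"

lemma has_wirtinger_poly_const: "has_wirtinger_poly (\<lambda>_. P) 0 0 z"
  by (simp add: has_wirtinger_poly_def has_wirtinger_const)

lemma has_wirtinger_poly_pCons:
  "has_wirtinger f a b z \<Longrightarrow> has_wirtinger_poly P A B z \<Longrightarrow>
    has_wirtinger_poly (\<lambda>z. pCons (f z) (P z)) (pCons a A) (pCons b B) z"
  by (auto simp: has_wirtinger_poly_def coeff_pCons split: nat.splits)

lemma has_wirtinger_poly_mult: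
  assumes "has_wirtinger_poly P A B z" "has_wirtinger_poly Q C D z"
  shows "has_wirtinger_poly (\<lambda>z. P z * Q z) (A * Q z + P z * C) (B * Q z + P z * D) z"
  using assms unfolding has_wirtinger_poly_def
  by (auto simp: coeff_mult simp flip: sum.distrib intro!: has_wirtinger_sum has_wirtinger_mult)

lemma has_wirtinger_poly_power:
  assumes "has_wirtinger_poly P A B z"
  shows "has_wirtinger_poly (\<lambda>z. P z ^ n) (of_nat n * P z ^ (n - 1) * A) (of_nat n * P z ^ (n - 1) * B) z"
proof (induction n)
  case 0
  show ?case by (simp add: has_wirtinger_poly_const)
next
  case (Suc n)
  have eq: "P z * (of_nat n * P z ^ (n - 1) * X) = of_nat n * P z ^ n * X" for X
    by (cases n) (simp_all add: algebra_simps)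
  then show ?case
    using has_wirtinger_poly_mult[OF assms Suc.IH] unfolding eq by (simp add: algebra_simps)
qed

text \<open>Turns the scalars into constant polynomials, so that the product and power rules apply
  to every factor.\<close>

lemma e_poly_alt:
  "e_poly a b z = [:(-1) ^ b / fact a:] *
    ([:inverse (of_real (Im z)):] ^ b * ([:- z, 1:] ^ a * [:- cnj z, 1:] ^ b))"
proof -
  have "[:c:] ^ b = [:c ^ b:]" for c :: complex
    by (induction b) simp_all
  then show ?thesis
    by (simp add: e_poly_def power_int_minus power_inverse mult.commute)
qed

lemma poly_e_poly:
  "poly (e_poly a b z) x = (-1) ^ b / fact a * (inverse (of_real (Im z)) ^ b * ((x - z) ^ a * (x - cnj z) ^ b))"
  by (simp add: e_poly_alt)

text \<open>To be read with p = x - z, q = x - cnj z, w = 1/y and all polynomials evaluated at x. On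
  the left is the z-derivative of \<open>e_poly a b\<close> as the product rule gives it; the
  right-hand side expresses that raising in weight b - a leads to
  \<open>e_poly (a - 1) (b + 1)\<close>.\<close>

lemma e_poly_identity_wirtinger:
  fixes p q y w :: complex
  assumes "y * w = 1" "q = p + 2 * \<i> * y"
  shows "(-1) ^ b / fact a * (of_nat b * w ^ (b - 1) * (\<i> / 2 * w\<^sup>2) * (p ^ a * q ^ b) - w ^ b * (of_nat a * p ^ (a - 1) * q ^ b))
    = 1 / (2 * \<i>) * (if a = 0 then 0 else (-1) ^ (b + 1) / fact (a - 1) * (w ^ (b + 1) * (p ^ (a - 1) * q ^ (b + 1))))
      - ((of_nat b - of_nat a) * w / (2 * \<i>)) * ((-1) ^ b / fact a * (w ^ b * (p ^ a * q ^ b)))"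
proof -
  \<comment> \<open>For b = 0 the truncated exponent b - 1 is harmless, as the factor
    \<open>of_nat b\<close> vanishes.\<close>
  have b: "of_nat b * w ^ (b - 1) * (\<i> / 2 * w\<^sup>2) = of_nat b * w ^ b * (\<i> / 2 * w)"
    by (cases b) (simp_all add: power2_eq_square)
  have i: "c / (2 * \<i>) = - \<i> / 2 * c" for c :: complex
    by (simp add: field_simps)
  show ?thesis
  proof (cases a)
    case 0
    show ?thesis unfolding b i 0 by (simp add: field_simps)
  next
    case (Suc n)
    have "p ^ a = p * p ^ n" "q ^ (b + 1) = q * q ^ b" "w ^ (b + 1) = w * w ^ b"
      "(-1) ^ (b + 1) / fact (a - 1) = (- of_nat a) * ((-1) ^ b / (fact a :: complex))" "p ^ (a - 1) = p ^ n"
      by (simp_all add: Suc fact_Suc del: of_nat_Suc)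
    note eqs = this
    have "(of_nat b * w ^ b * (\<i> / 2 * w) * (p * p ^ n * q ^ b) - w ^ b * (of_nat a * p ^ n * q ^ b)) =
      - \<i> / 2 * ((- of_nat a) * (w * w ^ b * (p ^ n * (q * q ^ b)))) - (- \<i> / 2 * ((of_nat b - of_nat a) * w)) * (w ^ b * (p * p ^ n * q ^ b))"
      (is "?l = ?r")
    proof -
      \<comment> \<open>All terms share one monomial; what is left vanishes since w (q - p) = 2
        \<i>.\<close>
      have "?l - ?r = w ^ b * p ^ n * q ^ b * of_nat a * (- 1 - \<i> / 2 * (w * (q - p)))"
        by (simp add: algebra_simps)
      also have "w * (q - p) = 2 * \<i> * (y * w)" by (simp add: assms(2))
      finally show ?thesis by (simp add: assms(1))
    qed
    then have *: "K * ?l = K * ?r" for K by (rule arg_cong)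
    define K where "K = (-1) ^ b / (fact a :: complex)"
    show ?thesis unfolding b i eqs K_def[symmetric] using *[of K] Suc by (simp add: algebra_simps)
  qed
qed

text \<open>The same reading for the derivative in cnj z, which steps to
  \<open>e_poly (a + 1) (b - 1)\<close>. The factor a + 1 compensates the change from a! to (a +
  1)!, and b comes from differentiating b-th powers.\<close>

lemma e_poly_identity_wirtinger_cnj:
  fixes p q y w :: complex
  assumes "y * w = 1" "q = p + 2 * \<i> * y"
  shows "(-1) ^ b / fact a * (of_nat b * w ^ (b - 1) * (- \<i> / 2 * w\<^sup>2) * (p ^ a * q ^ b) - w ^ b * (p ^ a * (of_nat b * q ^ (b - 1))))
    = of_nat b * (of_nat a + 1) * w\<^sup>2 / (- 2 * \<i>) * ((-1) ^ (b - 1) / fact (a + 1) * (w ^ (b - 1) * (p ^ (a + 1) * q ^ (b - 1))))"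
proof (cases b)
  case (Suc n)
  have *: "- \<i> / 2 * w\<^sup>2 * q - w = - \<i> / 2 * w\<^sup>2 * p"
  proof -
    have "- \<i> / 2 * w\<^sup>2 * q - w = - \<i> / 2 * w\<^sup>2 * p + w * (y * w) - w"
      by (simp add: assms(2) field_simps power2_eq_square)
    then show ?thesis by (simp add: assms(1))
  qed
  have i: "c / (- 2 * \<i>) = \<i> / 2 * c" for c :: complex
    by (simp add: field_simps)
  have f: "(-1) ^ b / fact a = (of_nat a + 1) * (- ((-1) ^ n / (fact (a + 1) :: complex)))"
  proof -
    have "(fact (a + 1) :: complex) = (of_nat a + 1) * fact a" "complex_of_nat a + 1 \<noteq> 0"
      using of_nat_neq_0[of a, where ?'a = complex] by (simp_all add: algebra_simps)
    then show ?thesis by (simp add: Suc del: fact_Suc)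
  qed
  have "of_nat b * w ^ n * (- \<i> / 2 * w\<^sup>2) * (p ^ a * (q * q ^ n)) - w * w ^ n * (p ^ a * (of_nat b * q ^ n)) =
    of_nat b * w ^ n * p ^ a * q ^ n * (- \<i> / 2 * w\<^sup>2 * q - w)"
    by (simp add: algebra_simps)
  also have "\<dots> = of_nat b * w ^ n * p ^ a * q ^ n * (- \<i> / 2 * w\<^sup>2 * p)"
    unfolding * ..
  finally have "(-1) ^ b / fact a * (of_nat b * w ^ n * (- \<i> / 2 * w\<^sup>2) * (p ^ a * (q * q ^ n)) - w * w ^ n * (p ^ a * (of_nat b * q ^ n))) =
    (-1) ^ b / fact a * (of_nat b * w ^ n * p ^ a * q ^ n * (- \<i> / 2 * w\<^sup>2 * p))" (is "?L = ?R") by (rule arg_cong)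
  moreover have "?R = (of_nat a + 1) * (- ((-1) ^ n / (fact (a + 1) :: complex))) * (of_nat b * w ^ n * p ^ a * q ^ n * (- \<i> / 2 * w\<^sup>2 * p))"
    unfolding f ..
  ultimately show ?thesis
    unfolding i by (simp add: Suc algebra_simps add_divide_distrib)
qed simp

text \<open>Complex polynomials are determined by their values, so comparing the outcome of the
  product rule with the claimed derivatives reduces to the two scalar identities above.\<close>

lemma has_wirtinger_e_poly:
  assumes "z \<in> \<H>"
  shows "has_wirtinger_poly (e_poly a b)
    (smult (1 / (2 * \<i>)) (if a = 0 then 0 else e_poly (a - 1) (b + 1) z)
      - smult ((of_nat b - of_nat a) / (2 * \<i> * of_real (Im z))) (e_poly a b z))
    (smult (of_nat b * (of_nat a + 1) / (- 2 * \<i> * of_real (Im z) ^ 2)) (e_poly (a + 1) (b - 1) z)) z"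
proof -
  let ?W = "\<lambda>z. [:inverse (of_real (Im z)):] :: complex poly"
  let ?P = "\<lambda>z. [:- z, 1:] :: complex poly" and ?Q = "\<lambda>z. [:- cnj z, 1:] :: complex poly"
  define y where "y = complex_of_real (Im z)"
  have y: "y \<noteq> 0" "cnj z = z - 2 * \<i> * y"
    using assms by (auto simp: y_def upper_half_plane_def complex_eq_iff)
  have neg: "has_wirtinger f a b z \<Longrightarrow> has_wirtinger (\<lambda>z. - f z) (- a) (- b) z" for f :: "complex \<Rightarrow> complex" and a b
    using has_wirtinger_mult[OF has_wirtinger_const[of "-1"]] by simp
  have W: "has_wirtinger_poly ?W [:\<i> / 2 * inverse y ^ 2:] [:- \<i> / 2 * inverse y ^ 2:] z"
    using has_wirtinger_poly_pCons[OF has_wirtinger_inverse_Im has_wirtinger_poly_const[of 0], of z] y(1)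
    by (simp add: y_def)
  have P: "has_wirtinger_poly ?P [:-1:] 0 z"
    using has_wirtinger_poly_pCons[OF neg[OF has_wirtinger_id] has_wirtinger_poly_const[of "[:1:]"]] by simp
  have Q: "has_wirtinger_poly ?Q 0 [:-1:] z"
    using has_wirtinger_poly_pCons[OF neg[OF has_wirtinger_cnj] has_wirtinger_poly_const[of "[:1:]"]] by simp
  note main = has_wirtinger_poly_mult[OF has_wirtinger_poly_const[of "[:(-1) ^ b / fact a:]"]
    has_wirtinger_poly_mult[OF has_wirtinger_poly_power[OF W, of b]
      has_wirtinger_poly_mult[OF has_wirtinger_poly_power[OF P, of a] has_wirtinger_poly_power[OF Q, of b]]]]
  have cong: "has_wirtinger_poly P A B z \<Longrightarrow> P = P' \<Longrightarrow> A = A' \<Longrightarrow> B = B' \<Longrightarrow> has_wirtinger_poly P' A' B' z"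
    for P P' A A' B B' by simp
  have ext: "p = q" if "\<And>x. poly p x = poly q x" for p q :: "complex poly"
    using that by (simp add: poly_eq_poly_eq_iff[symmetric] fun_eq_iff)
  define w where "w = inverse (complex_of_real (Im z))"
  have yw: "y * w = 1" "inverse y = w" "\<And>c d. c / (d * y) = c * w / d" "\<And>c d. c / (d * y\<^sup>2) = c * w\<^sup>2 / d"
    using y(1) by (simp_all add: w_def y_def field_simps power2_eq_square)
  show ?thesis
  proof (rule cong[OF main], goal_cases)
    case 1
    show ?case by (simp add: fun_eq_iff e_poly_alt)
  next
    case 2
    show ?case
    proof (rule ext, goal_cases)
      case (1 x)
      have q: "x - cnj z = (x - z) + 2 * \<i> * y" by (simp add: y(2))
      show ?case
        unfolding if_distrib[of "\<lambda>p. poly p x"] poly_diff poly_smult poly_e_poly poly_0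
        unfolding y_def[symmetric] yw e_poly_identity_wirtinger[OF yw(1) q, symmetric]
        by simp
    qed
  next
    case 3
    show ?case
    proof (rule ext, goal_cases)
      case (1 x)
      have q: "x - cnj z = (x - z) + 2 * \<i> * y" by (simp add: y(2))
      show ?case
        unfolding poly_smult poly_e_poly
        unfolding y_def[symmetric] yw e_poly_identity_wirtinger_cnj[OF yw(1) q, symmetric]
        by simp
    qed
  qed
qed

section \<open>Product rules, smoothness and commutator of the raising and lowering
  operators\<close>

lemma wirtinger_cong:
  assumes "open S" "z \<in> S" "\<And>y. y \<in> S \<Longrightarrow> f y = g y"
  shows "wirtinger f z = wirtinger g z" "wirtinger_cnj f z = wirtinger_cnj g z"
  unfolding wirtinger_conv_dir_op wirtinger_cnj_conv_dir_op using dir_op_cong[OF assms] by auto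

lemma lower_op_cong:
  assumes "\<And>y. y \<in> \<H> \<Longrightarrow> f y = g y" "z \<in> \<H>"
  shows "lower_op k f z = lower_op k g z"
  using wirtinger_cong(2)[OF open_upper_half_plane assms(2,1)] by (simp add: lower_op_def)

lemma raise_op_cong:
  assumes "\<And>y. y \<in> \<H> \<Longrightarrow> f y = g y" "z \<in> \<H>"
  shows "raise_op k f z = raise_op k g z"
  using wirtinger_cong(1)[OF open_upper_half_plane assms(2,1)] assms by (simp add: raise_op_def)

lemma laplace_op_cong:
  assumes "\<And>y. y \<in> \<H> \<Longrightarrow> f y = g y" "z \<in> \<H>"
  shows "laplace_op k f z = laplace_op k g z"
  by (simp add: laplace_op_def raise_op_cong[OF lower_op_cong[OF assms(1)] assms(2)])

lemma lower_op_scaleC_fun: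
  assumes "c differentiable (at z)" "g differentiable (at z)"
  shows "lower_op k (\<lambda>z. c z *\<^sub>C g z) z = lower_op k' c z *\<^sub>C g z + c z *\<^sub>C lower_op l g z"
  by (simp add: lower_op_def wirtinger_scaleC_fun[OF assms] scaleC.scale_right_distrib scaleC_complex_def ac_simps)

text \<open>The zeroth order terms k/y and l/y add up to the one of weight k + l.\<close>

lemma raise_op_scaleC_fun:
  assumes "c differentiable (at z)" "g differentiable (at z)"
  shows "raise_op (k + l) (\<lambda>z. c z *\<^sub>C g z) z = raise_op k c z *\<^sub>C g z + c z *\<^sub>C raise_op l g z"
  by (simp add: raise_op_def wirtinger_scaleC_fun[OF assms] scaleC.scale_right_distrib
      scaleC.scale_left_distrib scaleC_complex_def ac_simps add_divide_distrib distrib_left)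

lemma lower_op_add:
  assumes "f differentiable (at z)" "g differentiable (at z)"
  shows "lower_op k (\<lambda>z. f z + g z) z = lower_op k f z + lower_op k g z"
  using assms by (simp add: lower_op_def wirtinger_cnj_conv_dir_op dir_op_add scaleC.scale_right_distrib)

lemma raise_op_add:
  assumes "f differentiable (at z)" "g differentiable (at z)"
  shows "raise_op k (\<lambda>z. f z + g z) z = raise_op k f z + raise_op k g z"
  using assms by (simp add: raise_op_def wirtinger_conv_dir_op dir_op_add scaleC.scale_right_distrib add_ac)

lemma lower_op_scaleC:
  assumes "f differentiable (at z)"
  shows "lower_op k (\<lambda>z. a *\<^sub>C f z) z = a *\<^sub>C lower_op k f z"
  using assms by (simp add: lower_op_def wirtinger_cnj_conv_dir_op dir_op_scaleC mult.commute)

lemma raise_op_scaleC: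
  assumes "f differentiable (at z)"
  shows "raise_op k (\<lambda>z. a *\<^sub>C f z) z = a *\<^sub>C raise_op k f z"
  using assms by (simp add: raise_op_def wirtinger_conv_dir_op dir_op_scaleC scaleC.scale_right_distrib mult.commute)

lemma smooth_on_lower_op:
  assumes "smooth_on \<H> f"
  shows "smooth_on \<H> (lower_op k f)"
proof -
  have "smooth_on \<H> (\<lambda>z. (- 2 * \<i>) *\<^sub>C (of_real (Im z) *\<^sub>C (of_real (Im z) *\<^sub>C wirtinger_cnj f z)))"
    unfolding wirtinger_cnj_conv_dir_op
    by (intro smooth_on_scaleC smooth_on_const smooth_on_Im smooth_on_dir_op assms open_upper_half_plane)
  then show ?thesis by (simp add: lower_op_def[abs_def] power2_eq_square mult.assoc)
qed

lemma smooth_on_raise_op: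
  assumes "smooth_on \<H> f"
  shows "smooth_on \<H> (raise_op k f)"
proof -
  have "smooth_on \<H> (\<lambda>z. (2 * \<i>) *\<^sub>C wirtinger f z + of_int k *\<^sub>C (inverse (of_real (Im z)) *\<^sub>C f z))"
    unfolding wirtinger_conv_dir_op
    by (intro smooth_on_add smooth_on_scaleC smooth_on_const smooth_on_inverse_Im smooth_on_dir_op assms open_upper_half_plane)
  then show ?thesis by (simp add: raise_op_def[abs_def] field_simps)
qed

lemma smooth_on_lower_iter: "smooth_on \<H> f \<Longrightarrow> smooth_on \<H> (lower_iter k j f)"
  by (induction j) (simp_all add: smooth_on_lower_op)

lemma smooth_on_raise_iter: "smooth_on \<H> f \<Longrightarrow> smooth_on \<H> (raise_iter k j f)"
  by (induction j) (simp_all add: smooth_on_raise_op)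

lemma laplace_op_add:
  assumes "smooth_on \<H> f" "smooth_on \<H> g" "z \<in> \<H>"
  shows "laplace_op k (\<lambda>z. f z + g z) z = laplace_op k f z + laplace_op k g z"
proof -
  have "raise_op (k - 2) (lower_op k (\<lambda>z. f z + g z)) z = raise_op (k - 2) (\<lambda>z. lower_op k f z + lower_op k g z) z"
    using assms by (intro raise_op_cong lower_op_add) (auto intro: smooth_on_differentiable)
  also have "\<dots> = raise_op (k - 2) (lower_op k f) z + raise_op (k - 2) (lower_op k g) z"
    using assms by (intro raise_op_add) (auto intro: smooth_on_differentiable smooth_on_lower_op)
  finally show ?thesis by (simp add: laplace_op_def)
qed

lemma laplace_op_scaleC:
  assumes "smooth_on \<H> f" "z \<in> \<H>"
  shows "laplace_op k (\<lambda>z. a *\<^sub>C f z) z = a *\<^sub>C laplace_op k f z"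
proof -
  have "raise_op (k - 2) (lower_op k (\<lambda>z. a *\<^sub>C f z)) z = raise_op (k - 2) (\<lambda>z. a *\<^sub>C lower_op k f z) z"
    using assms by (intro raise_op_cong lower_op_scaleC) (auto intro: smooth_on_differentiable)
  also have "\<dots> = a *\<^sub>C raise_op (k - 2) (lower_op k f) z"
    using assms by (intro raise_op_scaleC) (auto intro: smooth_on_differentiable smooth_on_lower_op)
  finally show ?thesis by (simp add: laplace_op_def)
qed

lemma laplace_op_zero: "laplace_op k (\<lambda>z. 0) z = 0"
  by (simp add: laplace_op_def raise_op_def lower_op_def[abs_def] wirtinger_def wirtinger_cnj_def)

lemma laplace_op_sum:
  assumes "\<And>i. i \<in> I \<Longrightarrow> smooth_on \<H> (f i)" "z \<in> \<H>"
  shows "laplace_op k (\<lambda>z. \<Sum>i\<in>I. f i z) z = (\<Sum>i\<in>I. laplace_op k (f i) z)"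
  using assms(1)
  by (induction I rule: infinite_finite_induct)
     (simp_all add: laplace_op_zero laplace_op_add smooth_on_sum[OF open_upper_half_plane] assms(2))

text \<open>The sl2 relation: the Laplacian is minus raising after lowering, so the commutator of
  lowering and raising in weight k is -k. The second order parts agree by symmetry of mixed
  derivatives, and the constant is produced by the cnj-derivative of k/y.\<close>

lemma lower_raise_commute:
  assumes "smooth_on \<H> f" "z \<in> \<H>"
  shows "lower_op (k + 2) (raise_op k f) z = - laplace_op k f z - of_int k *\<^sub>C f z"
proof -
  define y where "y = complex_of_real (Im z)"
  have y: "y \<noteq> 0" using assms(2) by (auto simp: y_def upper_half_plane_def)
  have dI: "has_wirtinger (\<lambda>z. inverse (of_real (Im z))) (\<i> / 2 * inverse y ^ 2) (- \<i> / 2 * inverse y ^ 2) z"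
    using has_wirtinger_inverse_Im[of z] y by (simp add: y_def)
  have dY: "has_wirtinger (\<lambda>z. complex_of_real (Im z)) (- \<i> / 2) (\<i> / 2) z"
  proof -
    have "((\<lambda>z. complex_of_real (Im z)) has_derivative (\<lambda>v. of_real (Im v))) (at z)"
      by (auto intro!: derivative_eq_intros)
    moreover have "complex_of_real (Im v) = v *\<^sub>C (- \<i> / 2) + cnj v *\<^sub>C (\<i> / 2)" for v
      by (simp add: scaleC_complex_def complex_eq_iff)
    ultimately show ?thesis by (simp add: has_wirtinger_def)
  qed
  note sm = smooth_on_dir_op[OF open_upper_half_plane assms(1)]
  have W: "has_wirtinger (wirtinger f) (wirtinger (wirtinger f) z) (wirtinger_cnj (wirtinger f) z) z"
    and V: "has_wirtinger (wirtinger_cnj f) (wirtinger (wirtinger_cnj f) z) (wirtinger_cnj (wirtinger_cnj f) z) z"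
    and F: "has_wirtinger f (wirtinger f z) (wirtinger_cnj f z) z"
    using smooth_on_differentiable[OF sm assms(2)] smooth_on_differentiable[OF assms]
    unfolding wirtinger_conv_dir_op[symmetric]
    by (intro has_wirtingerI; simp add: wirtinger_conv_dir_op wirtinger_cnj_conv_dir_op)+
  have sym: "wirtinger_cnj (wirtinger f) z = wirtinger (wirtinger_cnj f) z"
    unfolding wirtinger_conv_dir_op wirtinger_cnj_conv_dir_op
    by (rule dir_op_commute[OF open_upper_half_plane assms(2,1)])
  have R: "raise_op k f = (\<lambda>z. (2 * \<i>) *\<^sub>C wirtinger f z + of_int k *\<^sub>C inverse (of_real (Im z)) *\<^sub>C f z)"
    by (simp add: raise_op_def[abs_def] field_simps)
  have 1: "wirtinger_cnj (raise_op k f) z = (2 * \<i>) *\<^sub>C wirtinger (wirtinger_cnj f) z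
      + of_int k *\<^sub>C ((- \<i> / 2 * inverse y ^ 2) *\<^sub>C f z + inverse y *\<^sub>C wirtinger_cnj f z)"
    using has_wirtingerD(3)[OF has_wirtinger_add[OF
        has_wirtinger_scaleC[OF has_wirtinger_const[of "2 * \<i>"] W]
        has_wirtinger_scaleC[OF has_wirtinger_const[of "of_int k"] has_wirtinger_scaleC[OF dI F]]]]
    unfolding R by (simp add: sym y_def)
  have L: "lower_op k f = (\<lambda>z. (- 2 * \<i>) *\<^sub>C of_real (Im z) *\<^sub>C of_real (Im z) *\<^sub>C wirtinger_cnj f z)"
    by (simp add: lower_op_def[abs_def] power2_eq_square mult.assoc)
  have 2: "wirtinger (lower_op k f) z = (- 2 * \<i>) *\<^sub>C ((- \<i> / 2) *\<^sub>C y *\<^sub>C wirtinger_cnj f z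
      + y *\<^sub>C ((- \<i> / 2) *\<^sub>C wirtinger_cnj f z + y *\<^sub>C wirtinger (wirtinger_cnj f) z))"
    using has_wirtingerD(2)[OF has_wirtinger_scaleC[OF has_wirtinger_const[of "- 2 * \<i>"]
        has_wirtinger_scaleC[OF dY has_wirtinger_scaleC[OF dY V]]]]
    unfolding L by (simp add: y_def)
  define X where "X = wirtinger (wirtinger_cnj f) z"
  define Y where "Y = wirtinger_cnj f z"
  have "lower_op (k + 2) (raise_op k f) z = (4 * y\<^sup>2) *\<^sub>C X - (2 * \<i> * of_int k * y) *\<^sub>C Y - of_int k *\<^sub>C f z"
    unfolding lower_op_def 1 X_def[symmetric] Y_def[symmetric] y_def[symmetric]
    using y by (simp add: scaleC.scale_right_distrib field_simps power2_eq_square)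
  moreover have "laplace_op k f z = - ((4 * y\<^sup>2) *\<^sub>C X - (2 * \<i> * of_int k * y) *\<^sub>C Y)"
    unfolding laplace_op_def raise_op_def 2 X_def[symmetric] Y_def[symmetric] y_def[symmetric]
    unfolding lower_op_def Y_def[symmetric] y_def[symmetric]
    using y by (simp add: scaleC.scale_right_distrib field_simps power2_eq_square
        scaleC.scale_left_diff_distrib scaleC.scale_left_distrib scaleC.scale_right_diff_distrib
        flip: scaleC.scale_left_distrib)
  ultimately show ?thesis by simp
qed

section \<open>The Laplacian of a tensor product\<close>

abbreviation e_coeff :: "nat \<Rightarrow> nat \<Rightarrow> nat \<Rightarrow> complex \<Rightarrow> complex" where
  "e_coeff j a b z \<equiv> coeff (e_poly a b z) j"

lemma lower_op_e_coeff:
  assumes "z \<in> \<H>"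
  shows "lower_op k (e_coeff j a b) z = of_nat b * (of_nat a + 1) * e_coeff j (a + 1) (b - 1) z"
  using has_wirtingerD(3)[OF has_wirtinger_e_poly[OF assms, unfolded has_wirtinger_poly_def, rule_format]] assms
  by (simp add: lower_op_def scaleC_complex_def upper_half_plane_def)

text \<open>In weight b - a the zeroth order term of the raising operator cancels the multiple of
  \<open>e_poly a b\<close> in its z-derivative, leaving a pure step of the ladder.\<close>

lemma raise_op_e_coeff:
  assumes "z \<in> \<H>"
  shows "raise_op (int b - int a) (e_coeff j a b) z = (if a = 0 then 0 else e_coeff j (a - 1) (b + 1) z)"
  using has_wirtingerD(2)[OF has_wirtinger_e_poly[OF assms, unfolded has_wirtinger_poly_def, rule_format]] assms
  by (simp add: raise_op_def scaleC_complex_def upper_half_plane_def right_diff_distrib)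

text \<open>Both Wirtinger derivatives are combinations of coefficients with the same or
  neighbouring indices and powers of 1/y, hence the induction runs over all a and b at once.\<close>

lemma smooth_on_e_coeff: "smooth_on \<H> (e_coeff j a b)"
proof -
  have "Cn_on n \<H> (e_coeff j a b)" for n a b
  proof (induction n arbitrary: a b)
    case 0
    have "e_coeff j a b differentiable (at z)" if "z \<in> \<H>" for z
      using has_wirtingerD(1) has_wirtinger_e_poly[OF that] unfolding has_wirtinger_poly_def by blast
    then show ?case
      by (auto intro!: continuous_at_imp_continuous_on differentiable_imp_continuous_within)
  next
    case (Suc n)
    define A where "A z = (1 / (2 * \<i>)) *\<^sub>C (if a = 0 then 0 else e_coeff j (a - 1) (b + 1) z)
        + (- (of_nat b - of_nat a) / (2 * \<i>)) *\<^sub>C (inverse (of_real (Im z)) *\<^sub>C e_coeff j a b z)" for z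
    define B where "B z = (of_nat b * (of_nat a + 1) / (- 2 * \<i>)) *\<^sub>C (inverse (of_real (Im z)) *\<^sub>C (inverse (of_real (Im z)) *\<^sub>C e_coeff j (a + 1) (b - 1) z))" for z
    have D: "(e_coeff j a b has_derivative (\<lambda>v. v *\<^sub>C A z + cnj v *\<^sub>C B z)) (at z)" if "z \<in> \<H>" for z
    proof -
      have key: "u / (d * y) = u / d * inverse y" for u d y :: complex
        by (simp only: divide_inverse inverse_mult_distrib mult.assoc)
      have eqA: "1 / (2 * \<i>) * x - (c - d) / (2 * \<i> * y) * e = 1 / (2 * \<i>) * x + (- (c - d) / (2 * \<i>)) * (inverse y * e)"
        and eqB: "c / (- 2 * \<i> * y\<^sup>2) * e = c / (- 2 * \<i>) * (inverse y * (inverse y * e))" for c d e x y :: complex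
        unfolding key power2_eq_square inverse_mult_distrib by (simp_all add: algebra_simps add_divide_distrib diff_divide_distrib)
      note w = has_wirtinger_e_poly[OF that, of a b, unfolded has_wirtinger_poly_def, THEN spec[of _ j]]
      have A: "coeff (smult (1 / (2 * \<i>)) (if a = 0 then 0 else e_poly (a - 1) (b + 1) z)
          - smult ((of_nat b - of_nat a) / (2 * \<i> * of_real (Im z))) (e_poly a b z)) j = A z"
        unfolding A_def scaleC_complex_def coeff_diff coeff_smult eqA by simp
      have B: "coeff (smult (of_nat b * (of_nat a + 1) / (- 2 * \<i> * of_real (Im z) ^ 2)) (e_poly (a + 1) (b - 1) z)) j = B z"
        unfolding B_def scaleC_complex_def coeff_smult eqB ..
      show ?thesis
        using w unfolding A B has_wirtinger_def .
    qed
    have I: "Cn_on n \<H> (\<lambda>z. inverse (complex_of_real (Im z)))"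
      using smooth_on_inverse_Im by (simp add: smooth_on_def)
    have "Cn_on n \<H> (\<lambda>z. if a = 0 then 0 else e_coeff j (a - 1) (b + 1) z)"
      by (cases "a = 0") (simp_all only: if_True if_False Cn_on_const Suc simp_thms)
    then have A: "Cn_on n \<H> A"
      unfolding A_def[abs_def]
      by (intro Cn_on_add Cn_on_scaleC Cn_on_const I Suc open_upper_half_plane)
    have B: "Cn_on n \<H> B"
      unfolding B_def[abs_def] by (intro Cn_on_scaleC Cn_on_const I Suc open_upper_half_plane)
    show ?case
      by (rule Cn_on_SucI[OF open_upper_half_plane D])
         (assumption, intro Cn_on_add Cn_on_scaleC Cn_on_const A B open_upper_half_plane)
  qed
  then show ?thesis by (simp add: smooth_on_def)
qed

text \<open>The origin of the tridiagonal shape: applying the product rules for lowering and then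
  raising, the polynomial factor stays in place or moves one step, one way together with raising of
  g and the other way together with lowering of g.\<close>

lemma laplace_op_e_coeff_scaleC:
  assumes g: "smooth_on \<H> g" and z: "z \<in> \<H>" and k: "k = l + int b - int a"
  shows "laplace_op k (\<lambda>z. e_coeff j a b z *\<^sub>C g z) z =
    - (of_nat b * (of_nat a + 1)) *\<^sub>C (e_coeff j a b z *\<^sub>C g z + e_coeff j (a + 1) (b - 1) z *\<^sub>C raise_op l g z)
    - (if a = 0 then 0 else e_coeff j (a - 1) (b + 1) z *\<^sub>C lower_op l g z)
    + e_coeff j a b z *\<^sub>C laplace_op l g z"
proof -
  note diff = smooth_on_differentiable[OF smooth_on_e_coeff] smooth_on_differentiable[OF g]
    smooth_on_differentiable[OF smooth_on_lower_op[OF g]]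
  note sm = smooth_on_scaleC[OF open_upper_half_plane smooth_on_e_coeff]
  let ?h = "\<lambda>z. (of_nat b * (of_nat a + 1)) *\<^sub>C (e_coeff j (a + 1) (b - 1) z *\<^sub>C g z)"
  let ?h' = "\<lambda>z. e_coeff j a b z *\<^sub>C lower_op l g z"
  have low: "lower_op k (\<lambda>z. e_coeff j a b z *\<^sub>C g z) z = ?h z + ?h' z" if "z \<in> \<H>" for z
    using lower_op_scaleC_fun[OF diff(1)[OF that] diff(2)[OF that], of k a b j l l] lower_op_e_coeff[OF that, of l a b j]
    by simp
  have "raise_op (k - 2) (lower_op k (\<lambda>z. e_coeff j a b z *\<^sub>C g z)) z = raise_op (k - 2) (\<lambda>z. ?h z + ?h' z) z"
    by (rule raise_op_cong[OF low z])
  also have "\<dots> = raise_op (k - 2) ?h z + raise_op (k - 2) ?h' z"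
    by (intro raise_op_add smooth_on_differentiable[OF _ z] smooth_on_scaleC open_upper_half_plane smooth_on_const
        smooth_on_e_coeff g smooth_on_lower_op)
  also have "raise_op (k - 2) ?h z = (of_nat b * (of_nat a + 1)) *\<^sub>C
      (e_coeff j a b z *\<^sub>C g z + e_coeff j (a + 1) (b - 1) z *\<^sub>C raise_op l g z)"
  \<comment> \<open>For b = 0 the weight does not split as needed below, because b - 1 is truncated;
    but then the factor b removes the whole term.\<close>
  proof (cases b)
    case 0
    then show ?thesis by (simp add: raise_op_def wirtinger_def)
  next
    case (Suc n)
    have eq: "k - 2 = (int (b - 1) - int (a + 1)) + l" using Suc k by simp
    show ?thesis
      by (subst raise_op_scaleC, intro smooth_on_differentiable[OF _ z] sm g)
         (simp add: eq raise_op_scaleC_fun[OF diff(1)[OF z] diff(2)[OF z]] raise_op_e_coeff[OF z] del: of_nat_Suc, simp add: Suc)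
  qed
  also have "raise_op (k - 2) ?h' z = (if a = 0 then 0 else e_coeff j (a - 1) (b + 1) z *\<^sub>C lower_op l g z)
      - e_coeff j a b z *\<^sub>C laplace_op l g z"
  proof -
    have eq: "k - 2 = (int b - int a) + (l - 2)" using k by simp
    show ?thesis
      by (simp add: eq raise_op_scaleC_fun[OF diff(1)[OF z] diff(3)[OF z]] raise_op_e_coeff[OF z] laplace_op_def)
  qed
  finally show ?thesis by (simp add: laplace_op_def)
qed

section \<open>Smooth families of functions on the upper half-plane\<close>

text \<open>Joint smoothness, not smoothness of the slices alone, is what permits exchanging
  derivatives in s and in \<tau>.\<close>

definition smooth_family :: "complex set \<Rightarrow> (complex \<Rightarrow> complex \<Rightarrow> 'v::complex_normed_space) \<Rightarrow> bool" where
  "smooth_family U f \<longleftrightarrow> open U \<and> smooth_on (U \<times> \<H>) (\<lambda>(s, \<tau>). f s \<tau>)"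

lemma open_Times_upper_half_plane: "open U \<Longrightarrow> open (U \<times> \<H>)"
  by (intro open_Times open_upper_half_plane)

lemma smooth_family_cong:
  assumes "smooth_family U f" "\<And>s \<tau>. s \<in> U \<Longrightarrow> \<tau> \<in> \<H> \<Longrightarrow> f s \<tau> = g s \<tau>"
  shows "smooth_family U g"
proof -
  have "smooth_on (U \<times> \<H>) (\<lambda>(s, \<tau>). g s \<tau>)"
    by (rule smooth_on_cong[of _ "\<lambda>(s, \<tau>). f s \<tau>"])
       (use assms in \<open>auto simp: smooth_family_def intro: open_Times_upper_half_plane\<close>)
  then show ?thesis using assms(1) by (simp add: smooth_family_def)
qed

lemma smooth_family_fst:
  assumes "open U" "smooth_on U g"
  shows "smooth_family U (\<lambda>s \<tau>. g s)"
proof -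
  have "smooth_on (U \<times> \<H>) (\<lambda>x. g (fst x + 0))"
    by (rule smooth_on_compose_affine[OF _ bounded_linear_fst _ assms(2)])
       (use assms in \<open>auto intro: open_Times_upper_half_plane\<close>)
  then show ?thesis using assms(1) unfolding smooth_family_def case_prod_beta' by simp
qed

lemma smooth_family_snd:
  assumes "open U" "smooth_on \<H> g"
  shows "smooth_family U (\<lambda>s \<tau>. g \<tau>)"
proof -
  have "smooth_on (U \<times> \<H>) (\<lambda>x. g (snd x + 0))"
    by (rule smooth_on_compose_affine[OF _ bounded_linear_snd _ assms(2)])
       (use assms in \<open>auto intro: open_Times_upper_half_plane\<close>)
  then show ?thesis using assms(1) unfolding smooth_family_def case_prod_beta' by simp
qed

lemma smooth_family_add:
  "smooth_family U f \<Longrightarrow> smooth_family U g \<Longrightarrow> smooth_family U (\<lambda>s \<tau>. f s \<tau> + g s \<tau>)"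
  unfolding smooth_family_def case_prod_beta' by (auto intro: smooth_on_add open_Times_upper_half_plane)

lemma smooth_family_scaleC:
  "smooth_family U f \<Longrightarrow> smooth_family U g \<Longrightarrow> smooth_family U (\<lambda>s \<tau>. f s \<tau> *\<^sub>C g s \<tau>)"
  unfolding smooth_family_def case_prod_beta' by (auto intro: smooth_on_scaleC open_Times_upper_half_plane)

lemma smooth_family_const: "open U \<Longrightarrow> smooth_family U (\<lambda>s \<tau>. c)"
  unfolding smooth_family_def case_prod_beta' by (simp add: smooth_on_const)

lemma smooth_family_sum:
  assumes "open U" "\<And>i. i \<in> I \<Longrightarrow> smooth_family U (f i)"
  shows "smooth_family U (\<lambda>s \<tau>. \<Sum>i\<in>I. f i s \<tau>)"
  using assms(2)
  by (induction I rule: infinite_finite_induct)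
     (auto intro: smooth_family_const smooth_family_add assms(1))

lemma smooth_family_slice_snd:
  assumes "smooth_family U f" "s \<in> U"
  shows "smooth_on \<H> (f s)"
proof -
  have "smooth_on \<H> (\<lambda>z. (\<lambda>(s, \<tau>). f s \<tau>) ((0, z) + (s, 0)))"
    by (rule smooth_on_compose_affine[where T = "U \<times> \<H>"])
       (use assms in \<open>auto intro!: open_upper_half_plane bounded_linear_intros simp: smooth_family_def\<close>)
  then show ?thesis by simp
qed

lemma smooth_family_slice_fst:
  assumes "smooth_family U f" "\<tau> \<in> \<H>"
  shows "smooth_on U (\<lambda>s. f s \<tau>)"
proof -
  have "smooth_on U (\<lambda>z. (\<lambda>(s, \<tau>). f s \<tau>) ((z, 0) + (0, \<tau>)))"
    by (rule smooth_on_compose_affine[where T = "U \<times> \<H>"])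
       (use assms in \<open>auto intro!: bounded_linear_intros simp: smooth_family_def\<close>)
  then show ?thesis by simp
qed

text \<open>Slices are compositions with affine embeddings, so by the chain rule their derivatives
  are directional derivatives of the joint function.\<close>

lemma
  assumes "smooth_family U f" "s \<in> U" "\<tau> \<in> \<H>"
  shows dir_op_slice_snd: "dir_op u w c (f s) \<tau> = dir_op (0, u) (0, w) c (\<lambda>(s, \<tau>). f s \<tau>) (s, \<tau>)"
    and dir_op_slice_fst: "dir_op u w c (\<lambda>s. f s \<tau>) s = dir_op (u, 0) (w, 0) c (\<lambda>(s, \<tau>). f s \<tau>) (s, \<tau>)"
proof -
  let ?F = "\<lambda>(s, \<tau>). f s \<tau>"
  have D: "(?F has_derivative frechet_derivative ?F (at (s, \<tau>))) (at (s, \<tau>))"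
    using assms by (intro smooth_on_has_derivative) (auto simp: smooth_family_def)
  have "((\<lambda>z. (s, z)) has_derivative (\<lambda>v. (0, v))) (at \<tau>)" "((\<lambda>z. (z, \<tau>)) has_derivative (\<lambda>v. (v, 0))) (at s)"
    by (auto intro!: derivative_eq_intros)
  note this[THEN has_derivative_compose, OF D]
  then
  have "frechet_derivative (f s) (at \<tau>) v = frechet_derivative ?F (at (s, \<tau>)) (0, v)"
    "frechet_derivative (\<lambda>s. f s \<tau>) (at s) v = frechet_derivative ?F (at (s, \<tau>)) (v, 0)" for v
    by (simp_all add: has_derivative_imp_frechet)
  then show "dir_op u w c (f s) \<tau> = dir_op (0, u) (0, w) c ?F (s, \<tau>)"
    "dir_op u w c (\<lambda>s. f s \<tau>) s = dir_op (u, 0) (w, 0) c ?F (s, \<tau>)"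
    by (simp_all add: dir_op_def)
qed

lemma smooth_family_dir_op_snd:
  assumes "smooth_family U f"
  shows "smooth_family U (\<lambda>s. dir_op u w c (f s))"
proof -
  have "smooth_family U (\<lambda>s \<tau>. dir_op (0, u) (0, w) c (\<lambda>(s, \<tau>). f s \<tau>) (s, \<tau>))"
    using assms unfolding smooth_family_def case_prod_eta
    by (blast intro: smooth_on_dir_op open_Times_upper_half_plane)
  then show ?thesis
    by (rule smooth_family_cong) (simp add: dir_op_slice_snd[OF assms])
qed

lemma smooth_family_dir_op_fst:
  assumes "smooth_family U f"
  shows "smooth_family U (\<lambda>s \<tau>. dir_op u w c (\<lambda>s. f s \<tau>) s)"
proof -
  have "smooth_family U (\<lambda>s \<tau>. dir_op (u, 0) (w, 0) c (\<lambda>(s, \<tau>). f s \<tau>) (s, \<tau>))"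
    using assms unfolding smooth_family_def case_prod_eta
    by (blast intro: smooth_on_dir_op open_Times_upper_half_plane)
  then show ?thesis
    by (rule smooth_family_cong) (simp add: dir_op_slice_fst[OF assms])
qed

text \<open>Lifted to the product, both operators become instances of \<open>dir_op\<close> on one
  jointly smooth function, where \<open>dir_op_commute\<close> applies.\<close>

lemma dir_op_slices_commute:
  assumes f: "smooth_family U f" and s: "s \<in> U" "\<tau> \<in> \<H>"
  shows "dir_op u w c (\<lambda>s. dir_op u' w' c' (f s) \<tau>) s = dir_op u' w' c' (\<lambda>\<tau>. dir_op u w c (\<lambda>s. f s \<tau>) s) \<tau>"
proof -
  let ?F = "\<lambda>(s, \<tau>). f s \<tau>"
  have U: "open (U \<times> \<H>)" "(s, \<tau>) \<in> U \<times> \<H>" "smooth_on (U \<times> \<H>) ?F"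
    using f s by (auto simp: smooth_family_def intro: open_Times_upper_half_plane)
  have "dir_op u w c (\<lambda>s. dir_op u' w' c' (f s) \<tau>) s
      = dir_op (u, 0) (w, 0) c (\<lambda>(s, \<tau>). dir_op u' w' c' (f s) \<tau>) (s, \<tau>)"
    by (rule dir_op_slice_fst[OF smooth_family_dir_op_snd[OF f] s])
  also have "\<dots> = dir_op (u, 0) (w, 0) c (dir_op (0, u') (0, w') c' ?F) (s, \<tau>)"
    by (rule dir_op_cong[OF U(1,2)]) (auto simp: dir_op_slice_snd[OF f])
  also have "\<dots> = dir_op (0, u') (0, w') c' (dir_op (u, 0) (w, 0) c ?F) (s, \<tau>)"
    by (rule dir_op_commute[OF U])
  also have "\<dots> = dir_op (0, u') (0, w') c' (\<lambda>(s, \<tau>). dir_op u w c (\<lambda>s. f s \<tau>) s) (s, \<tau>)"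
    by (rule dir_op_cong[OF U(1,2)]) (auto simp: dir_op_slice_fst[OF f])
  also have "\<dots> = dir_op u' w' c' (\<lambda>\<tau>. dir_op u w c (\<lambda>s. f s \<tau>) s) \<tau>"
    by (rule dir_op_slice_snd[OF smooth_family_dir_op_fst[OF f] s, symmetric])
  finally show ?thesis .
qed

lemma smooth_family_lower_op:
  assumes "smooth_family U f"
  shows "smooth_family U (\<lambda>s. lower_op k (f s))"
proof -
  have "open U" using assms by (simp add: smooth_family_def)
  then have "smooth_family U (\<lambda>s z. (- 2 * \<i>) *\<^sub>C (of_real (Im z) *\<^sub>C (of_real (Im z) *\<^sub>C wirtinger_cnj (f s) z)))"
    unfolding wirtinger_cnj_conv_dir_op
    by (intro smooth_family_scaleC smooth_family_const smooth_family_snd[OF _ smooth_on_Im]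
        smooth_family_dir_op_snd assms)
  then show ?thesis by (simp add: lower_op_def[abs_def] power2_eq_square mult.assoc)
qed

lemma smooth_family_raise_op:
  assumes "smooth_family U f"
  shows "smooth_family U (\<lambda>s. raise_op k (f s))"
proof -
  have "open U" using assms by (simp add: smooth_family_def)
  then have "smooth_family U (\<lambda>s z. (2 * \<i>) *\<^sub>C wirtinger (f s) z + of_int k *\<^sub>C (inverse (of_real (Im z)) *\<^sub>C f s z))"
    unfolding wirtinger_conv_dir_op
    by (intro smooth_family_add smooth_family_scaleC smooth_family_const smooth_family_snd[OF _ smooth_on_inverse_Im]
        smooth_family_dir_op_snd assms)
  then show ?thesis by (simp add: raise_op_def[abs_def] field_simps)
qed

lemma smooth_family_lower_iter: "smooth_family U f \<Longrightarrow> smooth_family U (\<lambda>s. lower_iter k j (f s))"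
  by (induction j) (simp_all add: smooth_family_lower_op)

lemma smooth_family_raise_iter: "smooth_family U f \<Longrightarrow> smooth_family U (\<lambda>s. raise_iter k j (f s))"
  by (induction j) (simp_all add: smooth_family_raise_op)

lemma smooth_family_wirtinger_fst:
  "smooth_family U f \<Longrightarrow> smooth_family U (\<lambda>s \<tau>. wirtinger (\<lambda>s. f s \<tau>) s)"
  unfolding wirtinger_conv_dir_op by (rule smooth_family_dir_op_fst)

lemma differentiable_slice_fst:
  "smooth_family U f \<Longrightarrow> s \<in> U \<Longrightarrow> \<tau> \<in> \<H> \<Longrightarrow> (\<lambda>s. f s \<tau>) differentiable (at s)"
  using smooth_on_differentiable[OF smooth_family_slice_fst] by blast

lemma wirtinger_lower_op_commute:
  assumes f: "smooth_family U f" and s: "s \<in> U" "\<tau> \<in> \<H>"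
  shows "wirtinger (\<lambda>s. lower_op k (f s) \<tau>) s = lower_op k (\<lambda>\<tau>. wirtinger (\<lambda>s. f s \<tau>) s) \<tau>"
  unfolding lower_op_def wirtinger_conv_dir_op wirtinger_cnj_conv_dir_op
  by (subst dir_op_scaleC[OF differentiable_slice_fst[OF smooth_family_dir_op_snd[OF f] s]])
     (simp add: dir_op_slices_commute[OF f s])

lemma wirtinger_raise_op_commute:
  assumes f: "smooth_family U f" and s: "s \<in> U" "\<tau> \<in> \<H>"
  shows "wirtinger (\<lambda>s. raise_op k (f s) \<tau>) s = raise_op k (\<lambda>\<tau>. wirtinger (\<lambda>s. f s \<tau>) s) \<tau>"
proof -
  note d = differentiable_slice_fst[OF smooth_family_dir_op_snd[OF f] s] differentiable_slice_fst[OF f s]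
  have dc: "(\<lambda>s. c *\<^sub>C h s) differentiable (at s)" if "h differentiable (at s)" for c and h :: "complex \<Rightarrow> 'a"
    using that bounded_linear.has_derivative[OF bounded_linear_scaleC] unfolding differentiable_def by blast
  show ?thesis
    unfolding raise_op_def wirtinger_conv_dir_op
    by (simp add: dir_op_add[OF dc dc] d dir_op_scaleC[OF d(1)] dir_op_scaleC[OF d(2)] dir_op_slices_commute[OF f s])
qed

lemma wirtinger_laplace_op_commute:
  assumes f: "smooth_family U f" and s: "s \<in> U" "\<tau> \<in> \<H>"
  shows "wirtinger (\<lambda>s. laplace_op k (f s) \<tau>) s = laplace_op k (\<lambda>\<tau>. wirtinger (\<lambda>s. f s \<tau>) s) \<tau>"
proof -
  have "wirtinger (\<lambda>s. (-1) *\<^sub>C raise_op (k - 2) (lower_op k (f s)) \<tau>) s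
      = (-1) *\<^sub>C wirtinger (\<lambda>s. raise_op (k - 2) (lower_op k (f s)) \<tau>) s"
    unfolding wirtinger_conv_dir_op
    by (intro dir_op_scaleC differentiable_slice_fst[OF smooth_family_raise_op[OF smooth_family_lower_op[OF f]] s])
  also have "wirtinger (\<lambda>s. raise_op (k - 2) (lower_op k (f s)) \<tau>) s
      = raise_op (k - 2) (\<lambda>\<tau>. wirtinger (\<lambda>s. lower_op k (f s) \<tau>) s) \<tau>"
    by (rule wirtinger_raise_op_commute[OF smooth_family_lower_op[OF f] s])
  also have "\<dots> = raise_op (k - 2) (lower_op k (\<lambda>\<tau>. wirtinger (\<lambda>s. f s \<tau>) s)) \<tau>"
    by (rule raise_op_cong[OF wirtinger_lower_op_commute[OF f s(1)] s(2)])
  finally show ?thesis by (simp add: laplace_op_def)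
qed

subsection \<open>Iterated derivatives in the parameter\<close>

lemma wirtinger_iter_cong:
  assumes "open U" "s \<in> U" "\<And>s. s \<in> U \<Longrightarrow> g s = h s"
  shows "(wirtinger ^^ n) g s = (wirtinger ^^ n) h s"
  using assms(2)
proof (induction n arbitrary: s)
  case (Suc n)
  show ?case using wirtinger_cong(1)[OF assms(1) Suc.prems Suc.IH] by simp
qed (simp add: assms(3))

lemma smooth_on_wirtinger_iter: "open U \<Longrightarrow> smooth_on U g \<Longrightarrow> smooth_on U ((wirtinger ^^ n) g)"
  by (induction n) (simp_all add: wirtinger_conv_dir_op smooth_on_dir_op)

lemma wirtinger_iter_add:
  assumes "open U" "smooth_on U g" "smooth_on U h" "s \<in> U"
  shows "(wirtinger ^^ n) (\<lambda>s. g s + h s) s = (wirtinger ^^ n) g s + (wirtinger ^^ n) h s"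
  using assms(4)
proof (induction n arbitrary: s)
  case (Suc n)
  have "(wirtinger ^^ Suc n) (\<lambda>s. g s + h s) s = wirtinger (\<lambda>s. (wirtinger ^^ n) g s + (wirtinger ^^ n) h s) s"
    using wirtinger_cong(1)[OF assms(1) Suc.prems Suc.IH] by simp
  also have "\<dots> = (wirtinger ^^ Suc n) g s + (wirtinger ^^ Suc n) h s"
    unfolding wirtinger_conv_dir_op using Suc.prems
    by (subst dir_op_add)
       (auto intro: smooth_on_differentiable[OF smooth_on_wirtinger_iter[OF assms(1), unfolded wirtinger_conv_dir_op]] assms)
  finally show ?case .
qed simp

lemma wirtinger_iter_scaleC:
  assumes "open U" "smooth_on U g" "s \<in> U"
  shows "(wirtinger ^^ n) (\<lambda>s. c *\<^sub>C g s) s = c *\<^sub>C (wirtinger ^^ n) g s"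
  using assms(3)
proof (induction n arbitrary: s)
  case (Suc n)
  have "(wirtinger ^^ Suc n) (\<lambda>s. c *\<^sub>C g s) s = wirtinger (\<lambda>s. c *\<^sub>C (wirtinger ^^ n) g s) s"
    using wirtinger_cong(1)[OF assms(1) Suc.prems Suc.IH] by simp
  also have "\<dots> = c *\<^sub>C (wirtinger ^^ Suc n) g s"
    unfolding wirtinger_conv_dir_op using Suc.prems
    by (subst dir_op_scaleC)
       (auto intro: smooth_on_differentiable[OF smooth_on_wirtinger_iter[OF assms(1), unfolded wirtinger_conv_dir_op]] assms)
  finally show ?case .
qed simp

lemma wirtinger_iter_zero: "(wirtinger ^^ n) (\<lambda>s. 0) s = 0"
proof -
  have "(wirtinger ^^ n) (\<lambda>s. 0 :: 'a) = (\<lambda>s. 0)"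
    by (induction n) (simp_all add: wirtinger_def[abs_def])
  then show ?thesis by simp
qed

lemma wirtinger_iter_sum:
  assumes "open U" "\<And>i. i \<in> I \<Longrightarrow> smooth_on U (g i)" "s \<in> U"
  shows "(wirtinger ^^ n) (\<lambda>s. \<Sum>i\<in>I. g i s) s = (\<Sum>i\<in>I. (wirtinger ^^ n) (g i) s)"
  using assms(2)
  by (induction I rule: infinite_finite_induct)
     (simp_all add: wirtinger_iter_zero wirtinger_iter_add[OF assms(1) _ smooth_on_sum[OF assms(1)] assms(3)])

lemma smooth_on_ident: "open U \<Longrightarrow> smooth_on U (\<lambda>s. s)"
  by (rule smooth_on_bounded_linear[OF _ bounded_linear_ident])

text \<open>The Wirtinger derivative obeys the product rule and sends s to the constant 1, so
  Leibniz' rule has only two terms even if \<open>h\<close> is not holomorphic. For n = 0 the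
  truncated n - 1 comes with the factor 0.\<close>

lemma wirtinger_iter_ident_scaleC:
  assumes U: "open U" and h: "smooth_on U h" and "s \<in> U"
  shows "(wirtinger ^^ n) (\<lambda>s. s *\<^sub>C h s) s = s *\<^sub>C (wirtinger ^^ n) h s + of_nat n *\<^sub>C (wirtinger ^^ (n - 1)) h s"
  using assms(3)
proof (induction n arbitrary: s)
  case (Suc n)
  let ?h = "\<lambda>n. (wirtinger ^^ n) h"
  note sm = smooth_on_wirtinger_iter[OF U h]
  note ds = smooth_on_differentiable[OF smooth_on_ident[OF U] Suc.prems]
  note d = smooth_on_differentiable[OF sm Suc.prems]
  have "(wirtinger ^^ Suc n) (\<lambda>s. s *\<^sub>C h s) s = wirtinger (\<lambda>s. s *\<^sub>C ?h n s + of_nat n *\<^sub>C ?h (n - 1) s) s"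
    using wirtinger_cong(1)[OF U Suc.prems Suc.IH] by simp
  also have "\<dots> = wirtinger (\<lambda>s. s *\<^sub>C ?h n s) s + wirtinger (\<lambda>s. of_nat n *\<^sub>C ?h (n - 1) s) s"
    unfolding wirtinger_conv_dir_op
    by (intro dir_op_add smooth_on_differentiable[OF _ Suc.prems] smooth_on_scaleC U smooth_on_ident smooth_on_const
        sm[unfolded wirtinger_conv_dir_op])
  also have "wirtinger (\<lambda>s. s *\<^sub>C ?h n s) s = ?h n s + s *\<^sub>C ?h (Suc n) s"
    using has_wirtingerD(2)[OF has_wirtinger_id] by (simp add: wirtinger_scaleC_fun[OF ds d])
  also have "wirtinger (\<lambda>s. of_nat n *\<^sub>C ?h (n - 1) s) s = of_nat n *\<^sub>C wirtinger (?h (n - 1)) s"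
    unfolding wirtinger_conv_dir_op by (rule dir_op_scaleC[OF d[unfolded wirtinger_conv_dir_op]])
  also have "of_nat n *\<^sub>C wirtinger (?h (n - 1)) s = of_nat n *\<^sub>C ?h n s"
    by (cases n) simp_all
  finally show ?case by (simp add: scaleC.scale_left_distrib)
qed simp

lemma smooth_on_poly: "open U \<Longrightarrow> smooth_on U (poly (p :: complex poly))"
proof (induction p)
  case 0
  show ?case by (simp add: smooth_on_const)
next
  case (pCons c p)
  have "smooth_on U (\<lambda>s. c + s *\<^sub>C poly p s)"
    using pCons by (intro smooth_on_add smooth_on_scaleC smooth_on_const smooth_on_ident)
  then show ?case by (simp add: scaleC_complex_def)
qed

text \<open>The coefficients are those of Leibniz' rule; only their independence of \<open>h\<close> matters.\<close>

lemma wirtinger_iter_poly_scaleC: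
  assumes U: "open U" "0 \<in> U"
  shows "\<exists>a. \<forall>h::complex \<Rightarrow> 'v::complex_normed_space. smooth_on U h \<longrightarrow>
    (wirtinger ^^ n) (\<lambda>s. poly p s *\<^sub>C h s) 0 = (\<Sum>t\<le>n. a t *\<^sub>C (wirtinger ^^ (n - t)) h 0)"
proof (induction p arbitrary: n)
  case 0
  show ?case by (intro exI[of _ "\<lambda>_. 0"]) (simp add: wirtinger_iter_zero)
next
  case (pCons c p)
  obtain a where a: "\<And>h::complex \<Rightarrow> 'v. smooth_on U h \<Longrightarrow>
    (wirtinger ^^ (n - 1)) (\<lambda>s. poly p s *\<^sub>C h s) 0 = (\<Sum>t\<le>n - 1. a t *\<^sub>C (wirtinger ^^ (n - 1 - t)) h 0)"
    using pCons.IH by blast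
  show ?case
  \<comment> \<open>Horner step c + s p(s): at 0 the factor s contributes only n times the
    derivative of order n - 1, so the coefficients belonging to \<open>p\<close> move up by one
    place.\<close>
  proof (intro exI[of _ "\<lambda>t. case t of 0 \<Rightarrow> c | Suc t \<Rightarrow> of_nat n * a t"] allI impI)
    fix h :: "complex \<Rightarrow> 'v"
    assume h: "smooth_on U h"
    have ph: "smooth_on U (\<lambda>s. poly p s *\<^sub>C h s)"
      by (intro smooth_on_scaleC U smooth_on_poly h)
    have "(wirtinger ^^ n) (\<lambda>s. poly (pCons c p) s *\<^sub>C h s) 0
        = (wirtinger ^^ n) (\<lambda>s. c *\<^sub>C h s + s *\<^sub>C poly p s *\<^sub>C h s) 0"
      by (simp add: scaleC.scale_left_distrib)
    also have "\<dots> = (wirtinger ^^ n) (\<lambda>s. c *\<^sub>C h s) 0 + (wirtinger ^^ n) (\<lambda>s. s *\<^sub>C poly p s *\<^sub>C h s) 0"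
      by (intro wirtinger_iter_add[OF U(1) _ _ U(2)] smooth_on_scaleC U smooth_on_const h smooth_on_ident smooth_on_poly)
    also have "\<dots> = c *\<^sub>C (wirtinger ^^ n) h 0 + of_nat n *\<^sub>C (wirtinger ^^ (n - 1)) (\<lambda>s. poly p s *\<^sub>C h s) 0"
      by (simp only: wirtinger_iter_scaleC[OF U(1) h U(2)] wirtinger_iter_ident_scaleC[OF U(1) ph U(2)]
          scaleC.scale_zero_left add_0)
    also have "\<dots> = c *\<^sub>C (wirtinger ^^ n) h 0 + of_nat n *\<^sub>C (\<Sum>t\<le>n - 1. a t *\<^sub>C (wirtinger ^^ (n - 1 - t)) h 0)"
      unfolding a[OF h] ..
    also have "\<dots> = (\<Sum>t\<le>n. (case t of 0 \<Rightarrow> c | Suc t \<Rightarrow> of_nat n * a t) *\<^sub>C (wirtinger ^^ (n - t)) h 0)"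
      by (cases n) (simp_all add: sum.atMost_Suc_shift scaleC.scale_sum_right del: sum.atMost_Suc of_nat_Suc)
    finally show "(wirtinger ^^ n) (\<lambda>s. poly (pCons c p) s *\<^sub>C h s) 0
      = (\<Sum>t\<le>n. (case t of 0 \<Rightarrow> c | Suc t \<Rightarrow> of_nat n * a t) *\<^sub>C (wirtinger ^^ (n - t)) h 0)" .
  qed
qed

lemma smooth_family_wirtinger_iter:
  "smooth_family U f \<Longrightarrow> smooth_family U (\<lambda>s \<tau>. (wirtinger ^^ n) (\<lambda>s. f s \<tau>) s)"
  by (induction n) (simp_all add: smooth_family_wirtinger_fst)

lemma laplace_op_wirtinger_iter:
  assumes f: "smooth_family U f" and \<tau>: "\<tau> \<in> \<H>" and "s \<in> U"
  shows "laplace_op k (\<lambda>\<tau>. (wirtinger ^^ n) (\<lambda>s. f s \<tau>) s) \<tau> = (wirtinger ^^ n) (\<lambda>s. laplace_op k (f s) \<tau>) s"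
  using assms(3)
proof (induction n arbitrary: s)
  case (Suc n)
  have U: "open U" using f by (simp add: smooth_family_def)
  show ?case
    using wirtinger_laplace_op_commute[OF smooth_family_wirtinger_iter[OF f] Suc.prems \<tau>, of k n]
      wirtinger_cong(1)[OF U Suc.prems Suc.IH] by simp
qed simp

section \<open>Preimages under powers of the Laplacian\<close>

text \<open>Leibniz' rule twice, on s (q f - s f) at s = 0, where the undifferentiated factor s
  vanishes. The numerical factors are zero whenever n - 1 or n - 2 is truncated.\<close>

lemma laplace_op_jet:
  fixes q :: complex
  assumes f: "smooth_family U f" and "0 \<in> U" and \<tau>: "\<tau> \<in> \<H>"
    and eig: "\<And>s. s \<in> U \<Longrightarrow> laplace_op k (f s) \<tau> = (s * (q - s)) *\<^sub>C f s \<tau>"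
  shows "laplace_op k (\<lambda>\<tau>. (wirtinger ^^ n) (\<lambda>s. f s \<tau>) 0) \<tau> =
    (of_nat n * q) *\<^sub>C (wirtinger ^^ (n - 1)) (\<lambda>s. f s \<tau>) 0
    - (of_nat n * of_nat (n - 1)) *\<^sub>C (wirtinger ^^ (n - 2)) (\<lambda>s. f s \<tau>) 0"
proof -
  have U: "open U" using f by (simp add: smooth_family_def)
  note h = smooth_family_slice_fst[OF f \<tau>]
  note sm = smooth_on_add[OF U] smooth_on_scaleC[OF U] smooth_on_ident[OF U] smooth_on_const h
  let ?g = "\<lambda>s. q *\<^sub>C f s \<tau> + (-1) *\<^sub>C s *\<^sub>C f s \<tau>"
  have "laplace_op k (\<lambda>\<tau>. (wirtinger ^^ n) (\<lambda>s. f s \<tau>) 0) \<tau> = (wirtinger ^^ n) (\<lambda>s. laplace_op k (f s) \<tau>) 0"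
    by (rule laplace_op_wirtinger_iter[OF f \<tau> \<open>0 \<in> U\<close>])
  also have "\<dots> = (wirtinger ^^ n) (\<lambda>s. s *\<^sub>C ?g s) 0"
    by (rule wirtinger_iter_cong[OF U \<open>0 \<in> U\<close>])
       (simp add: eig right_diff_distrib scaleC.scale_right_diff_distrib scaleC.scale_left_diff_distrib)
  also have "\<dots> = of_nat n *\<^sub>C (wirtinger ^^ (n - 1)) ?g 0"
    by (subst wirtinger_iter_ident_scaleC[OF U _ \<open>0 \<in> U\<close>]) (intro sm, simp)
  also have "(wirtinger ^^ (n - 1)) ?g 0 = (wirtinger ^^ (n - 1)) (\<lambda>s. q *\<^sub>C f s \<tau>) 0
      + (wirtinger ^^ (n - 1)) (\<lambda>s. (-1) *\<^sub>C s *\<^sub>C f s \<tau>) 0"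
    by (intro wirtinger_iter_add[OF U _ _ \<open>0 \<in> U\<close>] sm)
  also have "(wirtinger ^^ (n - 1)) (\<lambda>s. (-1) *\<^sub>C s *\<^sub>C f s \<tau>) 0 = (-1) *\<^sub>C (wirtinger ^^ (n - 1)) (\<lambda>s. s *\<^sub>C f s \<tau>) 0"
    by (intro wirtinger_iter_scaleC[OF U _ \<open>0 \<in> U\<close>] sm)
  also have "(wirtinger ^^ (n - 1)) (\<lambda>s. s *\<^sub>C f s \<tau>) 0 = of_nat (n - 1) *\<^sub>C (wirtinger ^^ (n - 2)) (\<lambda>s. f s \<tau>) 0"
    by (subst wirtinger_iter_ident_scaleC[OF U h \<open>0 \<in> U\<close>]) (simp add: numeral_2_eq_2)
  also have "(wirtinger ^^ (n - 1)) (\<lambda>s. q *\<^sub>C f s \<tau>) 0 = q *\<^sub>C (wirtinger ^^ (n - 1)) (\<lambda>s. f s \<tau>) 0"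
    by (rule wirtinger_iter_scaleC[OF U h \<open>0 \<in> U\<close>])
  finally show ?thesis by (simp add: scaleC.scale_right_diff_distrib)
qed

lemma laplace_op_iter_cong:
  assumes "\<And>z. z \<in> \<H> \<Longrightarrow> f z = g z" "z \<in> \<H>"
  shows "(laplace_op k ^^ n) f z = (laplace_op k ^^ n) g z"
  using assms(2)
proof (induction n arbitrary: z)
  case (Suc n)
  show ?case using laplace_op_cong[OF Suc.IH Suc.prems] by simp
qed (simp add: assms(1))

lemma laplace_op_iter_jet:
  fixes q :: complex
  assumes f: "smooth_family U f" and "0 \<in> U"
    and eig: "\<And>s \<tau>. s \<in> U \<Longrightarrow> \<tau> \<in> \<H> \<Longrightarrow> laplace_op k (f s) \<tau> = (s * (q - s)) *\<^sub>C f s \<tau>"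
    and "\<tau> \<in> \<H>"
  shows "(laplace_op k ^^ d) (\<lambda>\<tau>. \<Sum>t\<le>d. a t *\<^sub>C (wirtinger ^^ t) (\<lambda>s. f s \<tau>) 0) \<tau> = (fact d * q ^ d * a d) *\<^sub>C f 0 \<tau>"
  using \<open>\<tau> \<in> \<H>\<close>
proof (induction d arbitrary: a \<tau>)
  case (Suc d)
  let ?F = "\<lambda>t \<tau>. (wirtinger ^^ t) (\<lambda>s. f s \<tau>) 0"
  \<comment> \<open>The coefficient of order t after one application, collected from the orders t +
    1 and t + 2; for t = d the latter would exceed the original order d + 1.\<close>
  define b where "b t = of_nat (Suc t) * q * a (Suc t)
      - (if t = d then 0 else of_nat (Suc (Suc t)) * of_nat (Suc t) * a (Suc (Suc t)))" for t
  have smF: "smooth_on \<H> (?F t)" for t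
    using smooth_family_slice_snd[OF smooth_family_wirtinger_iter[OF f] \<open>0 \<in> U\<close>] .
  have step: "laplace_op k (\<lambda>\<tau>. \<Sum>t\<le>Suc d. a t *\<^sub>C ?F t \<tau>) \<tau> = (\<Sum>t\<le>d. b t *\<^sub>C ?F t \<tau>)" if \<tau>: "\<tau> \<in> \<H>" for \<tau>
  proof -
    have "laplace_op k (\<lambda>\<tau>. \<Sum>t\<le>Suc d. a t *\<^sub>C ?F t \<tau>) \<tau> = (\<Sum>t\<le>Suc d. laplace_op k (\<lambda>\<tau>. a t *\<^sub>C ?F t \<tau>) \<tau>)"
      by (intro laplace_op_sum \<tau> smooth_on_scaleC open_upper_half_plane smooth_on_const smF)
    also have "\<dots> = (\<Sum>t\<le>Suc d. a t *\<^sub>C ((of_nat t * q) *\<^sub>C ?F (t - 1) \<tau> - (of_nat t * of_nat (t - 1)) *\<^sub>C ?F (t - 2) \<tau>))"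
      by (intro sum.cong refl) (simp only: laplace_op_scaleC[OF smF \<tau>] laplace_op_jet[OF f \<open>0 \<in> U\<close> \<tau> eig[OF _ \<tau>]])
    also have "\<dots> = (\<Sum>t\<le>d. (of_nat (Suc t) * q * a (Suc t)) *\<^sub>C ?F t \<tau>) -
        (\<Sum>t\<le>d. (of_nat (Suc t) * of_nat t * a (Suc t)) *\<^sub>C ?F (t - 1) \<tau>)"
      by (simp add: sum.atMost_Suc_shift scaleC.scale_right_diff_distrib sum_subtractf mult_ac
          del: sum.atMost_Suc of_nat_Suc)
    also have "(\<Sum>t\<le>d. (of_nat (Suc t) * of_nat t * a (Suc t)) *\<^sub>C ?F (t - 1) \<tau>) =
        (\<Sum>t\<le>d. (if t = d then 0 else of_nat (Suc (Suc t)) * of_nat (Suc t) * a (Suc (Suc t))) *\<^sub>C ?F t \<tau>)"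
    proof (cases d)
      case (Suc e)
      have "(\<Sum>t\<le>Suc e. (of_nat (Suc t) * of_nat t * a (Suc t)) *\<^sub>C ?F (t - 1) \<tau>) =
          (\<Sum>t\<le>e. (of_nat (Suc (Suc t)) * of_nat (Suc t) * a (Suc (Suc t))) *\<^sub>C ?F t \<tau>)"
        by (simp add: sum.atMost_Suc_shift del: sum.atMost_Suc of_nat_Suc)
      also have "\<dots> = (\<Sum>t\<le>Suc e. (if t = Suc e then 0 else of_nat (Suc (Suc t)) * of_nat (Suc t) * a (Suc (Suc t))) *\<^sub>C ?F t \<tau>)"
        by (auto intro!: sum.cong)
      finally show ?thesis unfolding Suc .
    qed simp
    finally show ?thesis
      by (simp only: b_def scaleC.scale_left_diff_distrib sum_subtractf)
  qed
  have "(laplace_op k ^^ Suc d) (\<lambda>\<tau>. \<Sum>t\<le>Suc d. a t *\<^sub>C ?F t \<tau>) \<tau> = (laplace_op k ^^ d) (\<lambda>\<tau>. \<Sum>t\<le>d. b t *\<^sub>C ?F t \<tau>) \<tau>"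
    unfolding funpow_Suc_right comp_apply by (rule laplace_op_iter_cong[OF step Suc.prems])
  also have "\<dots> = (fact d * q ^ d * b d) *\<^sub>C f 0 \<tau>"
    by (rule Suc.IH[OF Suc.prems])
  finally show ?case by (simp add: b_def algebra_simps)
qed simp

lemma laplace_Pol_iter: "(laplace_Pol k ^^ d) F \<tau> j = (laplace_op k ^^ d) (\<lambda>z. F z j) \<tau>"
proof (induction d arbitrary: \<tau>)
  case (Suc d)
  have "(\<lambda>z. (laplace_Pol k ^^ d) F z j) = (laplace_op k ^^ d) (\<lambda>z. F z j)"
    using Suc.IH by blast
  then show ?case by (simp add: laplace_Pol_def[of k "(laplace_Pol k ^^ d) F"])
qed simp

text \<open>The common core of both halves. The preimage is the d-th derivative of the eigenfamily
  at 0, divided by d! q^d. Leibniz' rule expands it into the generators, with scalars that are the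
  same for all \<tau> and j because the polynomial entries depend on s alone.\<close>

lemma preimage_in_span:
  fixes E :: "nat \<Rightarrow> complex \<Rightarrow> complex \<Rightarrow> nat \<Rightarrow> 'v::complex_normed_space" and q :: complex
  assumes U: "open U" "0 \<in> U" and "q \<noteq> 0"
    and E: "\<And>i j. smooth_family U (\<lambda>s \<tau>. E i s \<tau> j)"
    and eig: "\<And>s \<tau> j. s \<in> U \<Longrightarrow> \<tau> \<in> \<H> \<Longrightarrow>
      laplace_op k (\<lambda>z. \<Sum>i\<le>m. poly (c i) s *\<^sub>C E i s z j) \<tau> = (s * (q - s)) *\<^sub>C (\<Sum>i\<le>m. poly (c i) s *\<^sub>C E i s \<tau> j)"
  shows "\<exists>F\<in>span_Pol {(\<lambda>\<tau> j. (wirtinger ^^ (d - t)) (\<lambda>s. E i s \<tau> j) 0) | i t. i \<le> m \<and> t \<le> d}.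
    \<forall>\<tau>\<in>\<H>. (laplace_Pol k ^^ d) F \<tau> = (\<lambda>j. \<Sum>i\<le>m. poly (c i) 0 *\<^sub>C E i 0 \<tau> j)"
proof -
  interpret Pol: vector_space "scale_Pol :: complex \<Rightarrow> (complex \<Rightarrow> nat \<Rightarrow> 'v) \<Rightarrow> complex \<Rightarrow> nat \<Rightarrow> 'v"
    by (rule vector_space_scale_Pol)
  have "\<forall>i. \<exists>a. \<forall>h::complex \<Rightarrow> 'v. smooth_on U h \<longrightarrow>
    (wirtinger ^^ d) (\<lambda>s. poly (c i) s *\<^sub>C h s) 0 = (\<Sum>t\<le>d. a t *\<^sub>C (wirtinger ^^ (d - t)) h 0)"
    by (intro allI wirtinger_iter_poly_scaleC[OF U])
  \<comment> \<open>The scalars are chosen before any \<open>h\<close> is given: the same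
    \<open>a i\<close> has to serve every point and every coefficient index.\<close>
  from choice[OF this] obtain a where a: "\<And>i h. smooth_on U (h :: complex \<Rightarrow> 'v) \<Longrightarrow>
    (wirtinger ^^ d) (\<lambda>s. poly (c i) s *\<^sub>C h s) 0 = (\<Sum>t\<le>d. a i t *\<^sub>C (wirtinger ^^ (d - t)) h 0)"
    by blast
  \<comment> \<open>Cancels the factor produced by \<open>laplace_op_iter_jet\<close>.\<close>
  define K where "K = 1 / (fact d * q ^ d)"
  define G where "G i t = (\<lambda>\<tau> j. (wirtinger ^^ (d - t)) (\<lambda>s. E i s \<tau> j) 0)" for i t
  define F where "F = (\<Sum>i\<le>m. \<Sum>t\<le>d. scale_Pol (K * a i t) (G i t))"
  define \<Phi> where "\<Phi> j s \<tau> = (\<Sum>i\<le>m. poly (c i) s *\<^sub>C E i s \<tau> j)" for j s \<tau>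
  have sm: "smooth_family U (\<lambda>s \<tau>. poly (c i) s *\<^sub>C E i s \<tau> j)" for i j
    by (intro smooth_family_scaleC smooth_family_fst U smooth_on_poly E)
  have \<Phi>: "smooth_family U (\<Phi> j)" for j
    unfolding \<Phi>_def[abs_def] by (intro smooth_family_sum U sm)
  have sum_apply: "(\<Sum>x\<in>I. g x) \<tau> j = (\<Sum>x\<in>I. g x \<tau> j)" for g :: "nat \<Rightarrow> complex \<Rightarrow> nat \<Rightarrow> 'v" and I \<tau> j
    by (induction I rule: infinite_finite_induct) simp_all
  have "F \<in> span_Pol {G i t | i t. i \<le> m \<and> t \<le> d}"
    unfolding F_def by (intro Pol.span_sum Pol.span_scale Pol.span_base) auto
  moreover have "(laplace_Pol k ^^ d) F \<tau> j = \<Phi> j 0 \<tau>" if \<tau>: "\<tau> \<in> \<H>" for \<tau> j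
  proof -
    \<comment> \<open>Only the top derivative occurs; it is written as a full jet with a single
      possibly nonzero coefficient to match \<open>laplace_op_iter_jet\<close>.\<close>
    have F: "F z j = (\<Sum>t\<le>d. (if t = d then K else 0) *\<^sub>C (wirtinger ^^ t) (\<lambda>s. \<Phi> j s z) 0)" if z: "z \<in> \<H>" for z
    proof -
      have "(wirtinger ^^ d) (\<lambda>s. \<Phi> j s z) 0 = (\<Sum>i\<le>m. (wirtinger ^^ d) (\<lambda>s. poly (c i) s *\<^sub>C E i s z j) 0)"
        unfolding \<Phi>_def by (rule wirtinger_iter_sum[OF U(1) smooth_family_slice_fst[OF sm z] U(2)])
      also have "\<dots> = (\<Sum>i\<le>m. \<Sum>t\<le>d. a i t *\<^sub>C G i t z j)"
        by (simp add: a[OF smooth_family_slice_fst[OF E z]] G_def)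
      finally have *: "(wirtinger ^^ d) (\<lambda>s. \<Phi> j s z) 0 = (\<Sum>i\<le>m. \<Sum>t\<le>d. a i t *\<^sub>C G i t z j)" .
      have "F z j = K *\<^sub>C (wirtinger ^^ d) (\<lambda>s. \<Phi> j s z) 0"
        by (simp add: * F_def sum_apply scale_Pol_def scaleC.scale_sum_right)
      then show ?thesis by (simp add: if_distrib[of "\<lambda>x. x *\<^sub>C _"] cong: if_cong)
    qed
    have "(laplace_Pol k ^^ d) F \<tau> j = (laplace_op k ^^ d) (\<lambda>z. \<Sum>t\<le>d. (if t = d then K else 0) *\<^sub>C (wirtinger ^^ t) (\<lambda>s. \<Phi> j s z) 0) \<tau>"
      unfolding laplace_Pol_iter by (rule laplace_op_iter_cong[OF F \<tau>])
    also have "\<dots> = (fact d * q ^ d * (if d = d then K else 0)) *\<^sub>C \<Phi> j 0 \<tau>"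
      by (rule laplace_op_iter_jet[OF \<Phi> U(2) _ \<tau>]) (unfold \<Phi>_def, rule eig)
    finally show ?thesis using \<open>q \<noteq> 0\<close> by (simp add: K_def)
  qed
  ultimately show ?thesis
    unfolding G_def \<Phi>_def by blast
qed

section \<open>Eigenvalues\<close>

text \<open>The eigenvalue keeps its form s' (1 - k' - s'), now with k' = k - 2 j and s' = s + j. In
  the induction step the eigenvalue equation is lowered once more, and the sl2 relation subtracts
  the new weight.\<close>

lemma laplace_op_lower_iter:
  assumes g: "smooth_on \<H> g"
    and eig: "\<And>\<tau>. \<tau> \<in> \<H> \<Longrightarrow> laplace_op k g \<tau> = (s * (1 - of_int k - s)) *\<^sub>C g \<tau>"
    and "\<tau> \<in> \<H>"
  shows "laplace_op (k - 2 * int j) (lower_iter k j g) \<tau> =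
    ((s + of_nat j) * (1 - of_int k - s + of_nat j)) *\<^sub>C lower_iter k j g \<tau>"
  using assms(3)
proof (induction j arbitrary: \<tau>)
  case 0
  then show ?case by (simp add: eig)
next
  case (Suc j)
  let ?c = "(s + of_nat j) * (1 - of_int k - s + of_nat j)"
  define l where "l = k - 2 * int j"
  define h where "h = lower_iter k j g"
  have h: "smooth_on \<H> h" using g by (simp add: h_def smooth_on_lower_iter)
  have eig_h: "laplace_op l h z = ?c *\<^sub>C h z" if "z \<in> \<H>" for z
    using Suc.IH[OF that] by (simp add: l_def h_def)
  have raise: "raise_op (l - 2) (lower_op l h) z = (- ?c) *\<^sub>C h z" if "z \<in> \<H>" for z
    using eig_h[OF that] by (metis laplace_op_def minus_minus scaleC.scale_minus_left)
  have "- laplace_op (l - 2) (lower_op l h) \<tau> - of_int (l - 2) *\<^sub>C lower_op l h \<tau> =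
      lower_op l (raise_op (l - 2) (lower_op l h)) \<tau>"
    using lower_raise_commute[OF smooth_on_lower_op[OF h] Suc.prems, of "l - 2" l] by simp
  also have "\<dots> = lower_op l (\<lambda>z. (- ?c) *\<^sub>C h z) \<tau>"
    by (rule lower_op_cong[OF raise Suc.prems])
  also have "\<dots> = (- ?c) *\<^sub>C lower_op l h \<tau>"
    by (rule lower_op_scaleC[OF smooth_on_differentiable[OF h Suc.prems]])
  finally have "laplace_op (l - 2) (lower_op l h) \<tau> = (?c - of_int (l - 2)) *\<^sub>C lower_op l h \<tau>"
    by (simp add: scaleC.scale_left_diff_distrib algebra_simps)
  also have "?c - of_int (l - 2) = (s + of_nat (Suc j)) * (1 - of_int k - s + of_nat (Suc j))"
    by (simp add: l_def algebra_simps)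
  finally show ?case by (simp add: l_def h_def algebra_simps)
qed

text \<open>Here s' = s - j and k' = k + 2 j in s' (1 - k' - s'); the sl2 relation adds the old
  weight at each step.\<close>

lemma laplace_op_raise_iter:
  assumes g: "smooth_on \<H> g"
    and eig: "\<And>\<tau>. \<tau> \<in> \<H> \<Longrightarrow> laplace_op k g \<tau> = (s * (1 - of_int k - s)) *\<^sub>C g \<tau>"
    and "\<tau> \<in> \<H>"
  shows "laplace_op (k + 2 * int j) (raise_iter k j g) \<tau> =
    ((of_nat j - s) * (s + of_int k + of_nat j - 1)) *\<^sub>C raise_iter k j g \<tau>"
  using assms(3)
proof (induction j arbitrary: \<tau>)
  case 0
  then show ?case by (simp add: eig algebra_simps)
next
  case (Suc j)
  let ?\<kappa> = "(of_nat j - s) * (s + of_int k + of_nat j - 1)"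
  define l where "l = k + 2 * int j"
  define h where "h = raise_iter k j g"
  have h: "smooth_on \<H> h" using g by (simp add: h_def smooth_on_raise_iter)
  have low: "lower_op (l + 2) (raise_op l h) z = (- (?\<kappa> + of_int l)) *\<^sub>C h z" if "z \<in> \<H>" for z
    using Suc.IH[OF that]
    by (simp add: lower_raise_commute[OF h that] l_def[symmetric] h_def[symmetric]
        scaleC.scale_left_diff_distrib scaleC.scale_left_distrib)
  have "laplace_op (l + 2) (raise_op l h) \<tau> = - raise_op l (\<lambda>z. (- (?\<kappa> + of_int l)) *\<^sub>C h z) \<tau>"
    using raise_op_cong[OF low Suc.prems] by (simp add: laplace_op_def)
  also have "\<dots> = (?\<kappa> + of_int l) *\<^sub>C raise_op l h \<tau>"
    by (subst raise_op_scaleC[OF smooth_on_differentiable[OF h Suc.prems]])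
       (simp only: scaleC.scale_minus_left minus_minus)
  also have "?\<kappa> + of_int l = (of_nat (Suc j) - s) * (s + of_int k + of_nat (Suc j) - 1)"
    by (simp add: l_def algebra_simps)
  finally show ?case by (simp add: l_def h_def algebra_simps)
qed

section \<open>The tridiagonal eigenvector problem\<close>

text \<open>Passes from the action on the functions to the transposed action on their coefficients.
  The vanishing end values keep the shifted sums inside the range, and \<beta> 0 = 0 also disarms
  the truncated index i - 1.\<close>

lemma sum_tridiagonal:
  fixes E :: "nat \<Rightarrow> 'v::complex_normed_space"
  assumes "\<beta> 0 = 0" "\<beta> (Suc m) = 0" "\<gamma> m = 0"
  shows "(\<Sum>i\<le>m. b i *\<^sub>C (\<alpha> i *\<^sub>C E i + \<beta> i *\<^sub>C E (i - 1) + \<gamma> i *\<^sub>C E (Suc i))) =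
    (\<Sum>i\<le>m. (\<alpha> i * b i + \<beta> (Suc i) * b (Suc i) + (if i = 0 then 0 else \<gamma> (i - 1) * b (i - 1))) *\<^sub>C E i)"
proof -
  have "(\<Sum>i\<le>m. (\<beta> i * b i) *\<^sub>C E (i - 1)) = (\<Sum>i\<le>Suc m. (\<beta> i * b i) *\<^sub>C E (i - 1))"
    by (simp add: assms(2))
  also have "\<dots> = (\<Sum>i\<le>m. (\<beta> (Suc i) * b (Suc i)) *\<^sub>C E i)"
    by (subst sum.atMost_Suc_shift) (simp add: assms(1))
  finally have 1: "(\<Sum>i\<le>m. (\<beta> i * b i) *\<^sub>C E (i - 1)) = (\<Sum>i\<le>m. (\<beta> (Suc i) * b (Suc i)) *\<^sub>C E i)" .
  let ?h = "\<lambda>i. (if i = 0 then 0 else \<gamma> (i - 1) * b (i - 1)) *\<^sub>C E i"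
  have "(\<Sum>i\<le>m. (\<gamma> i * b i) *\<^sub>C E (Suc i)) = (\<Sum>i\<le>Suc m. ?h i)"
    by (subst sum.atMost_Suc_shift) simp
  also have "\<dots> = (\<Sum>i\<le>m. ?h i)"
    by (simp add: assms(3))
  finally have 2: "(\<Sum>i\<le>m. (\<gamma> i * b i) *\<^sub>C E (Suc i)) = (\<Sum>i\<le>m. ?h i)" .
  show ?thesis
    by (simp only: scaleC.scale_right_distrib scaleC.scale_scale scaleC.scale_left_distrib sum.distrib
        mult.commute[of "b _"] 1 2)
qed

lemma laplace_op_tridiagonal:
  fixes E :: "nat \<Rightarrow> complex \<Rightarrow> 'v::complex_normed_space"
  assumes "\<And>i. smooth_on \<H> (E i)" "\<tau> \<in> \<H>"
    and "\<And>i. i \<le> m \<Longrightarrow> laplace_op k (E i) \<tau> = \<alpha> i *\<^sub>C E i \<tau> + \<beta> i *\<^sub>C E (i - 1) \<tau> + \<gamma> i *\<^sub>C E (Suc i) \<tau>"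
    and "\<beta> 0 = 0" "\<beta> (Suc m) = 0" "\<gamma> m = 0"
    and "\<And>i. i \<le> m \<Longrightarrow> \<alpha> i * b i + \<beta> (Suc i) * b (Suc i) + (if i = 0 then 0 else \<gamma> (i - 1) * b (i - 1)) = \<mu> * b i"
  shows "laplace_op k (\<lambda>z. \<Sum>i\<le>m. b i *\<^sub>C E i z) \<tau> = \<mu> *\<^sub>C (\<Sum>i\<le>m. b i *\<^sub>C E i \<tau>)"
proof -
  have "laplace_op k (\<lambda>z. \<Sum>i\<le>m. b i *\<^sub>C E i z) \<tau> = (\<Sum>i\<le>m. laplace_op k (\<lambda>z. b i *\<^sub>C E i z) \<tau>)"
    by (intro laplace_op_sum smooth_on_scaleC open_upper_half_plane smooth_on_const assms(1,2))
  also have "\<dots> = (\<Sum>i\<le>m. b i *\<^sub>C (\<alpha> i *\<^sub>C E i \<tau> + \<beta> i *\<^sub>C E (i - 1) \<tau> + \<gamma> i *\<^sub>C E (Suc i) \<tau>))"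
    by (intro sum.cong refl) (simp only: laplace_op_scaleC[OF assms(1,2)] assms(3) atMost_iff)
  also have "\<dots> = (\<Sum>i\<le>m. (\<mu> * b i) *\<^sub>C E i \<tau>)"
    unfolding sum_tridiagonal[of \<beta> m \<gamma> b \<alpha> "\<lambda>i. E i \<tau>", OF assms(4-6)]
    by (intro sum.cong refl) (simp only: assms(7) atMost_iff)
  finally show ?thesis by (simp add: scaleC.scale_sum_right)
qed

text \<open>This is N (1-k-s)_m times 1 / ((m-r)! (1-k-s)_(m-r)), where the second factor is the
  coefficient from \<open>fL\<close> for m < k with k replaced by k + s. The common factor clears
  the denominators.\<close>

definition lower_coeff :: "int \<Rightarrow> nat \<Rightarrow> complex \<Rightarrow> nat \<Rightarrow> complex poly" where
  "lower_coeff k m N r = smult (N / fact (m - r)) (pochhammer [:1 - of_int k + of_nat (m - r), -1:] r)"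

text \<open>Likewise N (k+s)_m times 1 / ((m-r)! (k+s)_r), with the denominators cleared.\<close>

definition raise_coeff :: "int \<Rightarrow> nat \<Rightarrow> complex \<Rightarrow> nat \<Rightarrow> complex poly" where
  "raise_coeff k m N r = smult (N / fact (m - r)) (pochhammer [:of_int k + of_nat r, 1:] (m - r))"

lemma poly_pochhammer: "poly (pochhammer p n) x = pochhammer (poly p x :: 'a::comm_ring_1) n"
  by (simp add: pochhammer_prod poly_prod)

lemma poly_lower_coeff:
  "poly (lower_coeff k m N r) s = N / fact (m - r) * pochhammer (1 - of_int k - s + of_nat (m - r)) r"
  by (simp add: lower_coeff_def poly_pochhammer algebra_simps)

lemma poly_raise_coeff:
  "poly (raise_coeff k m N r) s = N / fact (m - r) * pochhammer (of_int k + s + of_nat r) (m - r)"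
  by (simp add: raise_coeff_def poly_pochhammer algebra_simps)

text \<open>A first order recursion, by which the three-term eigenvector equation collapses to a
  scalar identity.\<close>

lemma lower_coeff_Suc:
  assumes "r < m"
  shows "poly (lower_coeff k m N (Suc r)) s =
    of_nat (m - r) * (of_nat (m - r) - of_int k - s) * poly (lower_coeff k m N r) s"
proof -
  obtain j where j: "m - r = Suc j" "m - Suc r = j" using assms by (metis Suc_diff_Suc)
  have "pochhammer (1 - of_int k - s + of_nat j) (Suc r) = (of_nat (Suc j) - of_int k - s) * pochhammer (1 - of_int k - s + of_nat (Suc j)) r"
    by (simp add: pochhammer_rec algebra_simps)
  moreover have "N / fact j = of_nat (Suc j) * (N / fact (Suc j))"
    by (simp add: fact_Suc del: of_nat_Suc)
  ultimately show ?thesis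
    unfolding poly_lower_coeff j by (simp only: mult_ac)
qed

text \<open>Not solved for the next coefficient, because k + s + r may vanish.\<close>

lemma raise_coeff_Suc:
  assumes "r < m"
  shows "(of_int k + s + of_nat r) * poly (raise_coeff k m N (Suc r)) s = of_nat (m - r) * poly (raise_coeff k m N r) s"
proof -
  obtain j where j: "m - r = Suc j" "m - Suc r = j" using assms by (metis Suc_diff_Suc)
  have "pochhammer (of_int k + s + of_nat r) (Suc j) = (of_int k + s + of_nat r) * pochhammer (of_int k + s + of_nat (Suc r)) j"
    by (simp add: pochhammer_rec algebra_simps)
  then show ?thesis
    unfolding poly_raise_coeff j by (simp add: field_simps del: of_nat_Suc)
qed

text \<open>Once the recursion expresses both neighbours by the coefficient at r, the eigenvector
  equation reads c(n) - n (r + 1) - n (n - k - s) + r (s + n) = s (1 - k + m - s), where n = m - r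
  and c(n) is the eigenvalue of the n-th lowered iterate.\<close>

lemma laplace_op_sum_lower_iter:
  fixes g :: "complex \<Rightarrow> 'v::complex_normed_space"
  assumes g: "smooth_on \<H> g" and \<tau>: "\<tau> \<in> \<H>"
    and eig: "\<And>\<tau>. \<tau> \<in> \<H> \<Longrightarrow> laplace_op k g \<tau> = (s * (1 - of_int k - s)) *\<^sub>C g \<tau>"
  shows "laplace_op (k - int m) (\<lambda>z. \<Sum>r\<le>m. poly (lower_coeff k m N r) s *\<^sub>C (e_coeff j r (m - r) z *\<^sub>C lower_iter k (m - r) g z)) \<tau> =
    (s * (1 - of_int k + of_nat m - s)) *\<^sub>C (\<Sum>r\<le>m. poly (lower_coeff k m N r) s *\<^sub>C (e_coeff j r (m - r) \<tau> *\<^sub>C lower_iter k (m - r) g \<tau>))"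
proof -
  let ?c = "\<lambda>n. (s + of_nat n) * (1 - of_int k - s + of_nat n)"
  let ?L = "\<lambda>n. lower_iter k n g"
  let ?E = "\<lambda>r z. e_coeff j r (m - r) z *\<^sub>C ?L (m - r) z"
  note smL = smooth_on_lower_iter[OF g]
  have eigL: "laplace_op (k - 2 * int n) (?L n) z = ?c n *\<^sub>C ?L n z" if "z \<in> \<H>" for n z
    by (rule laplace_op_lower_iter[OF g eig that])
  show ?thesis
  proof (rule laplace_op_tridiagonal[where
        \<alpha> = "\<lambda>r. ?c (m - r) - of_nat (m - r) * (of_nat r + 1)" and
        \<beta> = "\<lambda>r. if r = 0 \<or> r > m then 0 else -1" and
        \<gamma> = "\<lambda>r. of_nat (m - r) * (of_nat r + 1) * ?c (m - r - 1)"])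
    fix r assume r: "r \<le> m"
    \<comment> \<open>Raising a lowered iterate returns the previous one up to its eigenvalue. For r
      = m there is no previous iterate, which the factor m - r takes care of.\<close>
    have raise: "of_nat (m - r) *\<^sub>C raise_op (k - 2 * int (m - r)) (?L (m - r)) \<tau> = - (of_nat (m - r) * ?c (m - r - 1)) *\<^sub>C ?L (m - r - 1) \<tau>"
    proof (cases "m - r")
      case (Suc n)
      show ?thesis
      proof -
        have "raise_op (k - 2 * int n - 2) (?L (Suc n)) \<tau> = - ?c n *\<^sub>C ?L n \<tau>"
          using eigL[OF \<tau>, of n] by (metis laplace_op_def lower_iter.simps(2) minus_minus scaleC.scale_minus_left)
        moreover have "k - 2 * int (Suc n) = k - 2 * int n - 2" by simp
        ultimately show ?thesis unfolding Suc by (simp only: diff_Suc_1 scaleC.scale_scale mult_minus_right)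
      qed
    qed simp
    have low: "lower_op (k - 2 * int (m - r)) (?L (m - r)) \<tau> = ?L (Suc (m - r)) \<tau>"
      by simp
    define e where "e = e_coeff j (r + 1) (m - r - 1) \<tau>"
    have "laplace_op (k - int m) (?E r) \<tau> =
      - (of_nat (m - r) * (of_nat r + 1)) *\<^sub>C (?E r \<tau> + e *\<^sub>C raise_op (k - 2 * int (m - r)) (?L (m - r)) \<tau>)
      - (if r = 0 then 0 else e_coeff j (r - 1) (m - r + 1) \<tau> *\<^sub>C lower_op (k - 2 * int (m - r)) (?L (m - r)) \<tau>)
      + e_coeff j r (m - r) \<tau> *\<^sub>C laplace_op (k - 2 * int (m - r)) (?L (m - r)) \<tau>"
      using r unfolding e_def by (intro laplace_op_e_coeff_scaleC smL \<tau>) simp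
    also have "- (of_nat (m - r) * (of_nat r + 1)) *\<^sub>C (?E r \<tau> + e *\<^sub>C raise_op (k - 2 * int (m - r)) (?L (m - r)) \<tau>)
      = - (of_nat (m - r) * (of_nat r + 1)) *\<^sub>C ?E r \<tau> - ((of_nat r + 1) * e) *\<^sub>C of_nat (m - r) *\<^sub>C raise_op (k - 2 * int (m - r)) (?L (m - r)) \<tau>"
      by (simp add: scaleC.scale_right_distrib mult_ac)
    also have "((of_nat r + 1) * e) *\<^sub>C of_nat (m - r) *\<^sub>C raise_op (k - 2 * int (m - r)) (?L (m - r)) \<tau>
      = - (of_nat (m - r) * (of_nat r + 1) * ?c (m - r - 1)) *\<^sub>C ?E (Suc r) \<tau>"
      unfolding raise by (simp add: e_def mult_ac)
    also have "(if r = 0 then 0 else e_coeff j (r - 1) (m - r + 1) \<tau> *\<^sub>C lower_op (k - 2 * int (m - r)) (?L (m - r)) \<tau>)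
      = - (if r = 0 \<or> r > m then 0 else -1) *\<^sub>C ?E (r - 1) \<tau>"
      using r unfolding low by (cases r) (simp_all add: Suc_diff_Suc)
    also have "e_coeff j r (m - r) \<tau> *\<^sub>C laplace_op (k - 2 * int (m - r)) (?L (m - r)) \<tau> = ?c (m - r) *\<^sub>C ?E r \<tau>"
      unfolding eigL[OF \<tau>] by (simp add: mult_ac)
    finally show "laplace_op (k - int m) (?E r) \<tau> = (?c (m - r) - of_nat (m - r) * (of_nat r + 1)) *\<^sub>C ?E r \<tau>
      + (if r = 0 \<or> r > m then 0 else -1) *\<^sub>C ?E (r - 1) \<tau>
      + (of_nat (m - r) * (of_nat r + 1) * ?c (m - r - 1)) *\<^sub>C ?E (Suc r) \<tau>"
      by (simp only: scaleC.scale_left_diff_distrib scaleC.scale_minus_left) (simp only: diff_conv_add_uminus minus_minus add_ac)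
  next
    fix r assume r: "r \<le> m"
    show "(?c (m - r) - of_nat (m - r) * (of_nat r + 1)) * poly (lower_coeff k m N r) s
      + (if Suc r = 0 \<or> Suc r > m then 0 else -1) * poly (lower_coeff k m N (Suc r)) s
      + (if r = 0 then 0 else of_nat (m - (r - 1)) * (of_nat (r - 1) + 1) * ?c (m - (r - 1) - 1) * poly (lower_coeff k m N (r - 1)) s)
      = s * (1 - of_int k + of_nat m - s) * poly (lower_coeff k m N r) s"
    proof -
      define x where "x = of_nat (m - r) - of_int k - s"
      let ?b = "\<lambda>r. poly (lower_coeff k m N r) s"
      have m: "complex_of_nat m = of_nat r + of_nat (m - r)"
        using r by (simp flip: of_nat_add)
      \<comment> \<open>At r = m the cutoff in \<beta> agrees with the factor m - r on the
        right.\<close>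
      have 1: "(if Suc r = 0 \<or> Suc r > m then 0 else -1) * ?b (Suc r) = - (of_nat (m - r) * x * ?b r)"
        using r by (cases "r < m") (auto simp: lower_coeff_Suc x_def)
      have 2: "(if r = 0 then 0 else of_nat (m - (r - 1)) * (of_nat (r - 1) + 1) * ?c (m - (r - 1) - 1) * ?b (r - 1))
        = of_nat r * (s + of_nat (m - r)) * ?b r"
      proof (cases r)
        case (Suc n)
        have d: "m - n = Suc (m - r)" using r Suc by simp
        \<comment> \<open>The recursion absorbs m - r + 1 and one of the two factors of
          \<open>?c (m - r)\<close>; the factor s + m - r remains.\<close>
        have "?b r = of_nat (Suc (m - r)) * (1 - of_int k - s + of_nat (m - r)) * ?b n"
          using lower_coeff_Suc[of n m k N s] r Suc by (simp add: d algebra_simps)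
        moreover have "complex_of_nat r = of_nat n + 1" using Suc by simp
        ultimately show ?thesis
          using Suc d by (simp del: of_nat_Suc)
      qed simp
      show ?thesis
        unfolding 1 2 m x_def by (simp add: algebra_simps)
    qed
  qed (use \<tau> in \<open>auto intro!: smooth_on_scaleC open_upper_half_plane smooth_on_e_coeff smL\<close>)
qed

text \<open>The mirror image: raising now leads to the next iterate, and lowering returns with an
  eigenvalue. After the recursion the identity is c(r) - (m - r) (r + 1) + (r + 1 - s) (m - r) - r
  (k + s + r - 1) = s (1 - k - m - s).\<close>

lemma laplace_op_sum_raise_iter:
  fixes g :: "complex \<Rightarrow> 'v::complex_normed_space"
  assumes g: "smooth_on \<H> g" and \<tau>: "\<tau> \<in> \<H>"
    and eig: "\<And>\<tau>. \<tau> \<in> \<H> \<Longrightarrow> laplace_op k g \<tau> = (s * (1 - of_int k - s)) *\<^sub>C g \<tau>"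
  shows "laplace_op (k + int m) (\<lambda>z. \<Sum>r\<le>m. poly (raise_coeff k m N r) s *\<^sub>C (e_coeff j r (m - r) z *\<^sub>C raise_iter k r g z)) \<tau> =
    (s * (1 - of_int k - of_nat m - s)) *\<^sub>C (\<Sum>r\<le>m. poly (raise_coeff k m N r) s *\<^sub>C (e_coeff j r (m - r) \<tau> *\<^sub>C raise_iter k r g \<tau>))"
proof -
  let ?c = "\<lambda>n. (of_nat n - s) * (s + of_int k + of_nat n - 1)"
  let ?R = "\<lambda>n. raise_iter k n g"
  let ?E = "\<lambda>r z. e_coeff j r (m - r) z *\<^sub>C ?R r z"
  note smR = smooth_on_raise_iter[OF g]
  have eigR: "laplace_op (k + 2 * int n) (?R n) z = ?c n *\<^sub>C ?R n z" if "z \<in> \<H>" for n z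
    by (rule laplace_op_raise_iter[OF g eig that])
  show ?thesis
  proof (rule laplace_op_tridiagonal[where
        \<alpha> = "\<lambda>r. ?c r - of_nat (m - r) * (of_nat r + 1)" and
        \<beta> = "\<lambda>r. if r = 0 \<or> r > m then 0 else ?c r" and
        \<gamma> = "\<lambda>r. - (of_nat (m - r) * (of_nat r + 1))"])
    fix r assume r: "r \<le> m"
    \<comment> \<open>By the sl2 relation, lowering undoes a raising up to minus the sum of the old
      eigenvalue and the old weight, and this sum is \<open>?c (Suc n)\<close>.\<close>
    have low: "lower_op (k + 2 * int (Suc n)) (?R (Suc n)) \<tau> = - ?c (Suc n) *\<^sub>C ?R n \<tau>" for n
    proof -
      have "lower_op (k + 2 * int n + 2) (?R (Suc n)) \<tau> = - ?c n *\<^sub>C ?R n \<tau> - of_int (k + 2 * int n) *\<^sub>C ?R n \<tau>"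
        using lower_raise_commute[OF smR \<tau>, of "k + 2 * int n" k n] eigR[OF \<tau>, of n]
        by simp
      also have "\<dots> = (- ?c n - of_int (k + 2 * int n)) *\<^sub>C ?R n \<tau>"
        by (simp only: scaleC.scale_left_diff_distrib)
      also have "- ?c n - of_int (k + 2 * int n) = - ?c (Suc n)"
        by (simp add: algebra_simps)
      finally show ?thesis by (simp add: algebra_simps)
    qed
    define e where "e = e_coeff j (r + 1) (m - r - 1) \<tau>"
    have "laplace_op (k + int m) (?E r) \<tau> =
      - (of_nat (m - r) * (of_nat r + 1)) *\<^sub>C (?E r \<tau> + e *\<^sub>C raise_op (k + 2 * int r) (?R r) \<tau>)
      - (if r = 0 then 0 else e_coeff j (r - 1) (m - r + 1) \<tau> *\<^sub>C lower_op (k + 2 * int r) (?R r) \<tau>)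
      + e_coeff j r (m - r) \<tau> *\<^sub>C laplace_op (k + 2 * int r) (?R r) \<tau>"
      using r unfolding e_def by (intro laplace_op_e_coeff_scaleC smR \<tau>) simp
    also have "- (of_nat (m - r) * (of_nat r + 1)) *\<^sub>C (?E r \<tau> + e *\<^sub>C raise_op (k + 2 * int r) (?R r) \<tau>)
      = - (of_nat (m - r) * (of_nat r + 1)) *\<^sub>C ?E r \<tau> + - (of_nat (m - r) * (of_nat r + 1)) *\<^sub>C ?E (Suc r) \<tau>"
      by (simp only: scaleC.scale_right_distrib e_def raise_iter.simps(2)) (simp only: Suc_eq_plus1 diff_diff_left)
    also have "(if r = 0 then 0 else e_coeff j (r - 1) (m - r + 1) \<tau> *\<^sub>C lower_op (k + 2 * int r) (?R r) \<tau>)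
      = - (if r = 0 \<or> r > m then 0 else ?c r) *\<^sub>C ?E (r - 1) \<tau>"
    proof (cases r)
      case (Suc n)
      then show ?thesis
        using r unfolding Suc low by (simp add: Suc_diff_Suc mult_ac)
    qed simp
    also have "e_coeff j r (m - r) \<tau> *\<^sub>C laplace_op (k + 2 * int r) (?R r) \<tau> = ?c r *\<^sub>C ?E r \<tau>"
      unfolding eigR[OF \<tau>] by (simp add: mult_ac)
    finally show "laplace_op (k + int m) (?E r) \<tau> = (?c r - of_nat (m - r) * (of_nat r + 1)) *\<^sub>C ?E r \<tau>
      + (if r = 0 \<or> r > m then 0 else ?c r) *\<^sub>C ?E (r - 1) \<tau>
      + - (of_nat (m - r) * (of_nat r + 1)) *\<^sub>C ?E (Suc r) \<tau>"
      by (simp only: scaleC.scale_left_diff_distrib scaleC.scale_minus_left) (simp only: diff_conv_add_uminus minus_minus add_ac)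
  next
    fix r assume r: "r \<le> m"
    show "(?c r - of_nat (m - r) * (of_nat r + 1)) * poly (raise_coeff k m N r) s
      + (if Suc r = 0 \<or> Suc r > m then 0 else ?c (Suc r)) * poly (raise_coeff k m N (Suc r)) s
      + (if r = 0 then 0 else - (of_nat (m - (r - 1)) * (of_nat (r - 1) + 1)) * poly (raise_coeff k m N (r - 1)) s)
      = s * (1 - of_int k - of_nat m - s) * poly (raise_coeff k m N r) s"
    proof -
      let ?b = "\<lambda>r. poly (raise_coeff k m N r) s"
      have m: "complex_of_nat m = of_nat r + of_nat (m - r)"
        using r by (simp flip: of_nat_add)
      have 1: "(if Suc r = 0 \<or> Suc r > m then 0 else ?c (Suc r)) * ?b (Suc r) = (of_nat r + 1 - s) * of_nat (m - r) * ?b r"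
      proof (cases "r < m")
        case True
        \<comment> \<open>\<open>?c (Suc r)\<close> contains k + s + r, the very factor that occurs
          in the recursion.\<close>
        have "?c (Suc r) * ?b (Suc r) = (of_nat r + 1 - s) * ((of_int k + s + of_nat r) * ?b (Suc r))"
          by (simp add: algebra_simps)
        then show ?thesis using True raise_coeff_Suc[OF True, of k s N] by simp
      qed (use r in simp)
      have 2: "(if r = 0 then 0 else - (of_nat (m - (r - 1)) * (of_nat (r - 1) + 1)) * ?b (r - 1))
        = - (of_nat r * (of_int k + s + of_nat r - 1) * ?b r)"
      proof (cases r)
        case (Suc n)
        have "of_nat (m - n) * ?b n = (of_int k + s + of_nat n) * ?b r"
          using raise_coeff_Suc[of n m k s N] r Suc by simp
        then have "of_nat r * (of_nat (m - n) * ?b n) = of_nat r * ((of_int k + s + of_nat n) * ?b r)"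
          by (rule arg_cong)
        then show ?thesis
          using Suc by (simp add: algebra_simps)
      qed simp
      show ?thesis
        unfolding 1 2 m by (simp add: algebra_simps)
    qed
  qed (use \<tau> in \<open>auto intro!: smooth_on_scaleC open_upper_half_plane smooth_on_e_coeff smR\<close>)
qed

section \<open>Normalization at s = 0\<close>

lemma pochhammer_Suc_of_nat: "pochhammer (of_nat (Suc n)) r = (fact (n + r) / fact n :: complex)"
proof -
  have "pochhammer (1 :: complex) (n + r) = pochhammer 1 n * pochhammer (of_nat (Suc n)) r"
    by (simp add: pochhammer_product')
  then have "fact (n + r) = fact n * pochhammer (of_nat (Suc n) :: complex) r"
    by (simp only: pochhammer_fact)
  then show ?thesis by (simp del: of_nat_Suc)
qed

text \<open>For k \<le> 0 the coefficient at s = 0 is N (m-k)! / ((m-r)! (m-r-k)!), which forces N =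
  1/(m-k)!. For k > m + 1 it is N (1-k)_m / ((m-r)! (1-k)_(m-r)); all factors of (1-k)_m are
  negative, so N can be its inverse.\<close>

lemma fL_eq_sum:
  assumes "k \<le> 0 \<or> k - int m > 1"
  shows "\<exists>N. \<forall>g \<tau> j. fL m k g \<tau> j =
    (\<Sum>r\<le>m. poly (lower_coeff k m N r) 0 *\<^sub>C tensor (e_poly r (m - r) \<tau>) (lower_iter k (m - r) g \<tau>) j)"
proof (cases "k \<le> 0")
  case True
  define n where "n = nat (- k)"
  have k: "k = - int n" using True by (simp add: n_def)
  have "poly (lower_coeff k m (1 / fact (m + n)) r) 0 = 1 / (fact (m - r) * fact (nat (int m - int r - k)))" if "r \<le> m" for r
  proof -
    have "1 - of_int k + of_nat (m - r) = (of_nat (Suc (m - r + n)) :: complex)" "nat (int m - int r - k) = m - r + n"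
      using that by (simp_all add: k nat_eq_iff of_nat_diff)
    then show ?thesis
      using that by (simp add: poly_lower_coeff pochhammer_Suc_of_nat del: of_nat_Suc)
  qed
  moreover have "nat (min (int m) (int m - k)) = m" "int m \<ge> k" using True by auto
  ultimately show ?thesis
    by (intro exI[of _ "1 / fact (m + n)"]) (simp add: fL_def atLeast0AtMost)
next
  case False
  then have k: "k > int m + 1" using assms by simp
  define x where "x = 1 - complex_of_int k"
  have nz: "pochhammer x m \<noteq> 0"
  proof
    assume "pochhammer x m = 0"
    then obtain i where i: "i < m" "x = - of_nat i" by (auto simp: pochhammer_eq_0_iff)
    then have "complex_of_int (1 - k) = of_int (- int i)" by (simp add: x_def)
    then have "1 - k = - int i" unfolding of_int_eq_iff .
    then show False using i k by simp
  qed
  have "poly (lower_coeff k m (1 / pochhammer x m) r) 0 = 1 / (fact (m - r) * pochhammer x (m - r))" if "r \<le> m" for r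
  proof -
    have "pochhammer x m = pochhammer x (m - r) * pochhammer (x + of_nat (m - r)) r"
      using pochhammer_product[of "m - r" m x] that by simp
    then show ?thesis using nz by (simp add: poly_lower_coeff flip: x_def)
  qed
  then show ?thesis
    using k by (intro exI[of _ "1 / pochhammer x m"]) (simp add: fL_def atLeast0AtMost x_def)
qed

text \<open>For k > 1, (k+r)_(m-r) = (m+k-1)! / (r+k-1)! leads to N = 1/(m+k-1)!. For k + m < 1 all
  factors of (k)_m are negative, so N can be its inverse.\<close>

lemma fR_eq_sum:
  assumes "k > 1 \<or> k + int m < 1"
  shows "\<exists>N. \<forall>g \<tau> j. fR m k g \<tau> j =
    (\<Sum>r\<le>m. poly (raise_coeff k m N r) 0 *\<^sub>C tensor (e_poly r (m - r) \<tau>) (raise_iter k r g \<tau>) j)"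
proof (cases "k > 1")
  case True
  define n where "n = nat (k - 1)"
  have k: "k = int (Suc n)" using True by (simp add: n_def)
  have "poly (raise_coeff k m (1 / fact (n + m)) r) 0 = 1 / (fact (m - r) * fact (nat (int r + k - 1)))" if "r \<le> m" for r
  proof -
    have "of_int k + of_nat r = (of_nat (Suc (n + r)) :: complex)" "nat (int r + k - 1) = n + r"
      by (simp_all add: k nat_eq_iff)
    then show ?thesis
      using that by (simp add: poly_raise_coeff pochhammer_Suc_of_nat del: of_nat_Suc)
  qed
  moreover have "nat (max 0 (1 - k)) = 0" "int m > - k" using True by auto
  ultimately show ?thesis
    by (intro exI[of _ "1 / fact (n + m)"]) (simp add: fR_def atLeast0AtMost)
next
  case False
  then have k: "k + int m < 1" using assms by simp
  define x where "x = complex_of_int k"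
  have nz: "pochhammer x m \<noteq> 0"
  proof
    assume "pochhammer x m = 0"
    then obtain i where i: "i < m" "x = - of_nat i" by (auto simp: pochhammer_eq_0_iff)
    then have "complex_of_int k = of_int (- int i)" by (simp add: x_def)
    then have "k = - int i" unfolding of_int_eq_iff .
    then show False using i k by simp
  qed
  have "poly (raise_coeff k m (1 / pochhammer x m) r) 0 = 1 / (fact (m - r) * pochhammer x r)" if "r \<le> m" for r
  proof -
    have "pochhammer x m = pochhammer x r * pochhammer (x + of_nat r) (m - r)"
      using pochhammer_product[OF that, of x] .
    then show ?thesis using nz by (simp add: poly_raise_coeff flip: x_def)
  qed
  then show ?thesis
    using k by (intro exI[of _ "1 / pochhammer x m"]) (simp add: fR_def atLeast0AtMost x_def)
qed

theorem theorem4p15: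
  fixes U :: "complex set" and k :: int and m :: nat
    and f :: "complex \<Rightarrow> complex \<Rightarrow> 'v::complex_normed_space"
  assumes "finite_dim_complex TYPE('v)"
    and "open U" and "0 \<in> U"
    and "smooth_on (U \<times> \<H>) (\<lambda>(s, \<tau>). f s \<tau>)"
    and "\<And>s \<tau>. s \<in> U \<Longrightarrow> \<tau> \<in> \<H> \<Longrightarrow>
           laplace_op k (f s) \<tau> = (s * (1 - of_int k - s)) *\<^sub>C f s \<tau>"
  shows "(k \<le> 0 \<or> k - int m > 1 \<longrightarrow>
           (\<forall>d::nat. \<exists>F \<in> span_Pol {fL_deriv m k f r (d - t) | r t. r \<le> m \<and> t \<le> d}.
              \<forall>\<tau>\<in>\<H>. (laplace_Pol (k - int m) ^^ d) F \<tau> = fL m k (f 0) \<tau>))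
       \<and> (k > 1 \<or> k + int m < 1 \<longrightarrow>
           (\<forall>d::nat. \<exists>F \<in> span_Pol {fR_deriv m k f r (d - t) | r t. r \<le> m \<and> t \<le> d}.
              \<forall>\<tau>\<in>\<H>. (laplace_Pol (k + int m) ^^ d) F \<tau> = fR m k (f 0) \<tau>))"
proof (intro conjI impI allI)
  fix d
  have f: "smooth_family U f" using assms(2,4) by (simp add: smooth_family_def)
  note U = assms(2,3)
  {
    assume k: "k \<le> 0 \<or> k - int m > 1"
    let ?E = "\<lambda>r s \<tau>. tensor (e_poly r (m - r) \<tau>) (lower_iter k (m - r) (f s) \<tau>)"
    obtain N where N: "\<And>g \<tau> j. fL m k (g :: complex \<Rightarrow> 'v) \<tau> j =
        (\<Sum>r\<le>m. poly (lower_coeff k m N r) 0 *\<^sub>C tensor (e_poly r (m - r) \<tau>) (lower_iter k (m - r) g \<tau>) j)"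
      using fL_eq_sum[OF k] by blast
    \<comment> \<open>This number is \<mu>'(0): positive for k \<le> 0, negative for k > m +
      1.\<close>
    have "1 - k + int m \<noteq> 0" using k by auto
    then have "complex_of_int (1 - k + int m) \<noteq> 0" unfolding of_int_eq_0_iff .
    then have q: "1 - of_int k + of_nat m \<noteq> (0 :: complex)" by simp
    have "\<exists>F\<in>span_Pol {(\<lambda>\<tau> j. (wirtinger ^^ (d - t)) (\<lambda>s. ?E r s \<tau> j) 0) | r t. r \<le> m \<and> t \<le> d}.
      \<forall>\<tau>\<in>\<H>. (laplace_Pol (k - int m) ^^ d) F \<tau> = (\<lambda>j. \<Sum>r\<le>m. poly (lower_coeff k m N r) 0 *\<^sub>C ?E r 0 \<tau> j)"
    proof (rule preimage_in_span[OF U q])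
      show "smooth_family U (\<lambda>s \<tau>. ?E r s \<tau> j)" for r j
        unfolding tensor_def
        by (intro smooth_family_scaleC smooth_family_snd U smooth_on_e_coeff smooth_family_lower_iter f)
      show "laplace_op (k - int m) (\<lambda>z. \<Sum>r\<le>m. poly (lower_coeff k m N r) s *\<^sub>C ?E r s z j) \<tau> =
        (s * (1 - of_int k + of_nat m - s)) *\<^sub>C (\<Sum>r\<le>m. poly (lower_coeff k m N r) s *\<^sub>C ?E r s \<tau> j)"
        if "s \<in> U" "\<tau> \<in> \<H>" for s \<tau> j
        unfolding tensor_def
        by (rule laplace_op_sum_lower_iter[OF smooth_family_slice_snd[OF f that(1)] that(2) assms(5)[OF that(1)]])
    qed
    moreover have "fL_deriv m k f r n = (\<lambda>\<tau> j. (wirtinger ^^ n) (\<lambda>s. ?E r s \<tau> j) 0)" for r n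
      by (intro ext) (simp add: fL_deriv_def)
    moreover have "fL m k (f 0) \<tau> = (\<lambda>j. \<Sum>r\<le>m. poly (lower_coeff k m N r) 0 *\<^sub>C ?E r 0 \<tau> j)" for \<tau>
      by (intro ext N)
    ultimately show "\<exists>F \<in> span_Pol {fL_deriv m k f r (d - t) | r t. r \<le> m \<and> t \<le> d}.
              \<forall>\<tau>\<in>\<H>. (laplace_Pol (k - int m) ^^ d) F \<tau> = fL m k (f 0) \<tau>"
      by (simp only:)
  next
    assume k: "k > 1 \<or> k + int m < 1"
    let ?E = "\<lambda>r s \<tau>. tensor (e_poly r (m - r) \<tau>) (raise_iter k r (f s) \<tau>)"
    obtain N where N: "\<And>g \<tau> j. fR m k (g :: complex \<Rightarrow> 'v) \<tau> j =
        (\<Sum>r\<le>m. poly (raise_coeff k m N r) 0 *\<^sub>C tensor (e_poly r (m - r) \<tau>) (raise_iter k r g \<tau>) j)"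
      using fR_eq_sum[OF k] by blast
    \<comment> \<open>Again \<mu>'(0): negative for k > 1, positive for k + m < 1.\<close>
    have "1 - k - int m \<noteq> 0" using k by auto
    then have "complex_of_int (1 - k - int m) \<noteq> 0" unfolding of_int_eq_0_iff .
    then have q: "1 - of_int k - of_nat m \<noteq> (0 :: complex)" by simp
    have "\<exists>F\<in>span_Pol {(\<lambda>\<tau> j. (wirtinger ^^ (d - t)) (\<lambda>s. ?E r s \<tau> j) 0) | r t. r \<le> m \<and> t \<le> d}.
      \<forall>\<tau>\<in>\<H>. (laplace_Pol (k + int m) ^^ d) F \<tau> = (\<lambda>j. \<Sum>r\<le>m. poly (raise_coeff k m N r) 0 *\<^sub>C ?E r 0 \<tau> j)"
    proof (rule preimage_in_span[OF U q])
      show "smooth_family U (\<lambda>s \<tau>. ?E r s \<tau> j)" for r j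
        unfolding tensor_def
        by (intro smooth_family_scaleC smooth_family_snd U smooth_on_e_coeff smooth_family_raise_iter f)
      show "laplace_op (k + int m) (\<lambda>z. \<Sum>r\<le>m. poly (raise_coeff k m N r) s *\<^sub>C ?E r s z j) \<tau> =
        (s * (1 - of_int k - of_nat m - s)) *\<^sub>C (\<Sum>r\<le>m. poly (raise_coeff k m N r) s *\<^sub>C ?E r s \<tau> j)"
        if "s \<in> U" "\<tau> \<in> \<H>" for s \<tau> j
        unfolding tensor_def
        by (rule laplace_op_sum_raise_iter[OF smooth_family_slice_snd[OF f that(1)] that(2) assms(5)[OF that(1)]])
    qed
    moreover have "fR_deriv m k f r n = (\<lambda>\<tau> j. (wirtinger ^^ n) (\<lambda>s. ?E r s \<tau> j) 0)" for r n
      by (intro ext) (simp add: fR_deriv_def)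
    moreover have "fR m k (f 0) \<tau> = (\<lambda>j. \<Sum>r\<le>m. poly (raise_coeff k m N r) 0 *\<^sub>C ?E r 0 \<tau> j)" for \<tau>
      by (intro ext N)
    ultimately show "\<exists>F \<in> span_Pol {fR_deriv m k f r (d - t) | r t. r \<le> m \<and> t \<le> d}.
              \<forall>\<tau>\<in>\<H>. (laplace_Pol (k + int m) ^^ d) F \<tau> = fR m k (f 0) \<tau>"
      by (simp only:)
  }
qed

end
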